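(* Let $n\ge 1$, $s\in(0,1)$, and let $\Omega\subset\mathbb{R}^n$ be open, bounded, with $C^{1,1}$ boundary. Let $\beta:\mathbb{R}^n\to[0,1]$ be measurable with $\beta=0$ in $\Omega$. Let $u:\mathbb{R}^n\to\mathbb{R}$ be such that $u\in C^{2s+\alpha}_{loc}(\Omega)\cap L^\infty(\Omega)$ for some $\alpha>0$ and $$\beta(x)u(x)+\big(1-\beta(x)\big)\widetilde{\mathcal N}_s u(x)=0\quad\text{for a.e. } x\in\mathbb{R}^n\setminus\Omega .$$ Then, for every $x\in\Omega$, $$(-\Delta)^s u(x)=(-\Delta)^s_\Omega u(x)-u(x)\,(-\Delta)^s\beta(x)+c_{n,s}\int_\Omega\big(u(x)-u(y)\big)\,k_\beta(x,y)\,dy$$ $$=c_{n,s}\,\mathrm{p.v.}\int_\Omega\big(u(x)-u(y)\big)\left(\frac1{|x-y|^{n+2s}}+k_\beta(x,y)\right)dy+u(x)\,c_{n,s}\int_{\mathbb{R}^n\setminus\Omega}\frac{\beta(y)}{|x-y|^{n+2s}}\,dy,$$ where $k_\beta:\Omega\times\Omega\to\mathbb{R}$ is given by $$k_\beta(x,y)=\int_{\mathbb{R}^n\setminus\Omega}\frac{1-\beta(z)}{|x-z|^{n+2s}\,|y-z|^{n+2s}\displaystyle\int_\Omega\frac{dw}{|z-w|^{n+2s}}}\,dz,\qquad x,y\in\Omega .$$ Moreover, $k_\beta$ is nonnegative, symmetric, continuous, and for any fixed $x\in\Omega$ there exists $C=C(x)>0$ such that $$k_\beta(x,y)\le C\big(1+|\ln\mathrm{dist}(y,N)|\big)\qquad\text{for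 any } y\in\Omega,$$ where $N:=\overline{\{z\in\mathbb{R}^n\setminus\Omega:\ \beta(z)\neq1\}}$ is the support of the restriction of $1-\beta$ to $\mathbb{R}^n\setminus\Omega$.
   Context: Here $c_{n,s}>0$ is a fixed normalizing constant depending only on $n$ and $s$. For a function $u:\mathbb{R}^n\to\mathbb{R}$, the fractional Laplacian is $$(-\Delta)^s u(x)=c_{n,s}\,\mathrm{p.v.}\int_{\mathbb{R}^n}\frac{u(x)-u(y)}{|x-y|^{n+2s}}\,dy=c_{n,s}\lim_{\varepsilon\downarrow0}\int_{\mathbb{R}^n\setminus B_\varepsilon(x)}\frac{u(x)-u(y)}{|x-y|^{n+2s}}\,dy .$$ The regional fractional Laplacian is $$(-\Delta)^s_\Omega u(x)=c_{n,s}\,\mathrm{p.v.}\int_\Omega\frac{u(x)-u(y)}{|x-y|^{n+2s}}\,dy,\qquad x\in\Omega .$$ In both cases (and for any integral over $\Omega$ marked p.v.) the principal value means the limit as $\varepsilon\downarrow0$ of the integral over the domain minus $B_\varepsilon(x)$. The (normalized) nonlocal normal derivative is $$\widetilde{\mathcal N}_s u(x)=\left(\int_\Omega\frac{dy}{|x-y|^{n+2s}}\right)^{-1}\int_\Omega\frac{u(x)-u(y)}{|x-y|^{n+2s}}\,dy,\qquad x\in\mathbb{R}^n\setminus\Omega .$$ For nonempty $\Sigma\subset\mathbb{R}^n$, $\mathrm{dist}(x,\Sigma)=\inf\{|x-y|:y\in\Sigma\}$; for $\Sigma=\emptyset$ one uses $\mathrm{dist}(x,\emptyset)=+\infty$.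 "Symmetric" means $k_\beta(x,y)=k_\beta(y,x)$. *)

theory Defs
  imports "HOL-Analysis.Analysis"
begin

text \<open>
  The space \<open>\<real>\<^sup>n\<close> is an arbitrary Euclidean space \<open>'a\<close> with \<open>n = DIM('a)\<close>.  Measurability and
  integration are with respect to Lebesgue measure, and \<open>c\<close> stands for the constant \<open>c\<^sub>n\<^sub>,\<^sub>s\<close>.
\<close>

section \<open>Hoelder spaces and regular domains\<close>

text \<open>
  \<open>Ck_holder_loc k \<theta> U f\<close> is \<open>f \<in> C\<^sup>k\<^sup>,\<^sup>\<theta>\<^sub>l\<^sub>o\<^sub>c(U)\<close> for open \<open>U\<close>: continuous derivatives up to order \<open>k\<close>,
  those of order \<open>k\<close> being \<open>\<theta>\<close>-Hoelder on compact subsets.  For \<open>\<theta> = 0\<close> the Hoelder bound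
  holds for every continuous function, so \<open>C\<^sup>k\<^sup>,\<^sup>0\<^sub>l\<^sub>o\<^sub>c = C\<^sup>k\<close>.
\<close>

primrec Ck_holder_loc :: "nat \<Rightarrow> real \<Rightarrow> 'a::euclidean_space set \<Rightarrow> ('a \<Rightarrow> real) \<Rightarrow> bool" where
  "Ck_holder_loc 0 \<theta> U f \<longleftrightarrow>
     continuous_on U f \<and>
     (\<forall>K. compact K \<and> K \<subseteq> U \<longrightarrow>
        (\<exists>C. \<forall>x\<in>K. \<forall>y\<in>K. \<bar>f x - f y\<bar> \<le> C * norm (x - y) powr \<theta>))"
| "Ck_holder_loc (Suc k) \<theta> U f \<longleftrightarrow>
     (\<forall>x\<in>U. f differentiable (at x)) \<and>
     (\<forall>i\<in>Basis. Ck_holder_loc k \<theta> U (\<lambda>x. frechet_derivative f (at x) i))"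

definition holder_loc :: "real \<Rightarrow> 'a::euclidean_space set \<Rightarrow> ('a \<Rightarrow> real) \<Rightarrow> bool" where
  "holder_loc \<gamma> U f \<longleftrightarrow> Ck_holder_loc (nat \<lfloor>\<gamma>\<rfloor>) (frac \<gamma>) U f"

definition Linfty_on :: "'a::euclidean_space set \<Rightarrow> ('a \<Rightarrow> real) \<Rightarrow> bool" where
  "Linfty_on U f \<longleftrightarrow>
     set_borel_measurable lebesgue U f \<and> (\<exists>M. AE x in lebesgue. x \<in> U \<longrightarrow> \<bar>f x\<bar> \<le> M)"

text \<open>
  Near each boundary point the set is, in some direction \<open>e\<close>, the region strictly above the
  graph of a \<open>C\<^sup>1\<^sup>,\<^sup>1\<close> function \<open>g\<close> of the orthogonal projection onto the hyperplane
  perpendicular to \<open>e\<close>.  Only the values of \<open>g\<close> on that hyperplane (a copy of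
  \<open>\<real>\<^sup>n\<^sup>-\<^sup>1\<close>, also for \<open>n = 1\<close>) and near the projection of \<open>p\<close> matter, so it is no loss that
  \<open>g\<close> is defined on the whole space and that \<open>C\<^sup>1\<^sup>,\<^sup>1\<close> is asked only locally.
\<close>

definition C11_boundary :: "'a::euclidean_space set \<Rightarrow> bool" where
  "C11_boundary \<Omega> \<longleftrightarrow>
     (\<forall>p\<in>frontier \<Omega>. \<exists>r>0. \<exists>e g. norm e = 1 \<and> Ck_holder_loc 1 1 UNIV g \<and>
        \<Omega> \<inter> ball p r = {x \<in> ball p r. x \<bullet> e > g (x - (x \<bullet> e) *\<^sub>R e)})"

section \<open>Nonlocal operators\<close>

text \<open>
  The limit in \<open>pv_integral\<close> and the Bochner integrals are meaningful only if they exist, which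
  is what \<open>pv_exists\<close> records.
\<close>

definition pv_exists :: "'a::euclidean_space set \<Rightarrow> 'a \<Rightarrow> ('a \<Rightarrow> real) \<Rightarrow> bool" where
  "pv_exists D x F \<longleftrightarrow>
     (\<forall>\<epsilon>>0. set_integrable lebesgue (D - ball x \<epsilon>) F) \<and>
     (\<exists>L. ((\<lambda>\<epsilon>. LINT y:(D - ball x \<epsilon>)|lebesgue. F y) \<longlongrightarrow> L) (at_right 0))"

definition pv_integral :: "'a::euclidean_space set \<Rightarrow> 'a \<Rightarrow> ('a \<Rightarrow> real) \<Rightarrow> real" where
  "pv_integral D x F = Lim (at_right 0) (\<lambda>\<epsilon>. LINT y:(D - ball x \<epsilon>)|lebesgue. F y)"

definition dpow :: "real \<Rightarrow> 'a::euclidean_space \<Rightarrow> 'a \<Rightarrow> real" where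
  "dpow s x y = norm (x - y) powr (real DIM('a) + 2 * s)"

definition diff_quot :: "real \<Rightarrow> ('a::euclidean_space \<Rightarrow> real) \<Rightarrow> 'a \<Rightarrow> 'a \<Rightarrow> real" where
  "diff_quot s u x y = (u x - u y) / dpow s x y"

definition frac_lap :: "real \<Rightarrow> real \<Rightarrow> ('a::euclidean_space \<Rightarrow> real) \<Rightarrow> 'a \<Rightarrow> real" where
  "frac_lap c s u x = c * pv_integral UNIV x (diff_quot s u x)"

definition reg_frac_lap ::
  "real \<Rightarrow> real \<Rightarrow> 'a::euclidean_space set \<Rightarrow> ('a \<Rightarrow> real) \<Rightarrow> 'a \<Rightarrow> real" where
  "reg_frac_lap c s \<Omega> u x = c * pv_integral \<Omega> x (diff_quot s u x)"

text \<open>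
  For \<open>x\<close> in the (null) boundary of \<open>\<Omega>\<close> the integral of \<open>1 / dpow s x y\<close> diverges; its formal value
  is then 0.  This affects neither \<open>nonlocal_normal\<close> almost everywhere nor \<open>k_beta\<close>.
\<close>

definition nonlocal_normal ::
  "real \<Rightarrow> 'a::euclidean_space set \<Rightarrow> ('a \<Rightarrow> real) \<Rightarrow> 'a \<Rightarrow> real" where
  "nonlocal_normal s \<Omega> u x =
     inverse (LINT y:\<Omega>|lebesgue. 1 / dpow s x y) * (LINT y:\<Omega>|lebesgue. diff_quot s u x y)"

definition k_beta_integrand ::
  "real \<Rightarrow> 'a::euclidean_space set \<Rightarrow> ('a \<Rightarrow> real) \<Rightarrow> 'a \<Rightarrow> 'a \<Rightarrow> 'a \<Rightarrow> real" where
  "k_beta_integrand s \<Omega> \<beta> x y z =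
     (1 - \<beta> z) / (dpow s x z * dpow s y z * (LINT w:\<Omega>|lebesgue. 1 / dpow s z w))"

definition k_beta ::
  "real \<Rightarrow> 'a::euclidean_space set \<Rightarrow> ('a \<Rightarrow> real) \<Rightarrow> 'a \<Rightarrow> 'a \<Rightarrow> real" where
  "k_beta s \<Omega> \<beta> x y = (LINT z:(- \<Omega>)|lebesgue. k_beta_integrand s \<Omega> \<beta> x y z)"

section \<open>Distance and logarithm in the extended reals\<close>

definition ext_dist :: "'a::metric_space \<Rightarrow> 'a set \<Rightarrow> ereal" where
  "ext_dist x S = (INF y\<in>S. ereal (dist x y))" \<comment> \<open>equals \<open>\<infinity>\<close> for empty \<open>S\<close>\<close>

definition ext_ln :: "ereal \<Rightarrow> ereal" where
  "ext_ln t = (if t = \<infinity> then \<infinity> else if t \<le> 0 then - \<infinity> else ereal (ln (real_of_ereal t)))"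

definition robin_support :: "'a::euclidean_space set \<Rightarrow> ('a \<Rightarrow> real) \<Rightarrow> 'a set" where
  "robin_support \<Omega> \<beta> = closure {z \<in> - \<Omega>. \<beta> z \<noteq> 1}"

end

theory Submission
  imports Defs
begin

text \<open>
  Write \<open>p = n + 2s\<close> and \<open>mass z = \<integral>\<^sub>\<Omega> |z - w|\<^sup>-\<^sup>p dw\<close>.  Outside \<open>\<Omega>\<close> the Robin condition is pointwise
  solvable: \<open>u = (1 - \<beta>) avg\<close> a.e., where \<open>avg z\<close> is the average of \<open>u\<close> over \<open>\<Omega>\<close> with weight
  \<open>|z - y|\<^sup>-\<^sup>p\<close>.  Hence \<open>u x - u z = \<beta> z u x + (1 - \<beta> z) (u x - avg z)\<close> there, and exchanging the
  integrals in the last term produces \<open>k\<^sub>\<beta>\<close>.  The exchange needs no bound on \<open>k\<^sub>\<beta>\<close>, because the factor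
  \<open>mass z\<close> in its denominator cancels when one integrates in \<open>y\<close> first.  The principal value in
  \<open>\<Omega>\<close> exists since the linear Taylor term of \<open>u\<close> is odd and integrates to zero over annuli.

  For the logarithmic bound, the interior corkscrew condition gives \<open>mass z \<ge> C\<^sup>-\<^sup>1 dist(z, \<Omega>)\<^sup>-\<^sup>2\<^sup>s\<close> near \<open>\<Omega>\<close>, and
  \<open>dist(z, \<Omega>) \<le> |y - z|\<close>, so the integrand of \<open>k\<^sub>\<beta>(x, y)\<close> is at most \<open>C(x) |y - z|\<^sup>-\<^sup>n\<close> there, and it
  vanishes for \<open>|y - z| < dist(y, N)\<close>.
\<close>

section \<open>Integrals of power kernels\<close>

text \<open>Outside \<Omega> the only information about \<open>u\<close> is the Robin identity
  almost everywhere; neither measurability nor boundedness is given there. The exterior part of the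
  integral for \<open>u\<close> is therefore not estimated directly: integrability is proved for the
  explicit expression in \<open>avg\<close> and carried over by almost everywhere equality, which is
  enough because Lebesgue measure is complete. The boundary regularity acts in two ways. Because the
  frontier is null, almost every exterior point has positive distance from \<Omega>, and there
  \<open>mass\<close> is a convergent positive integral. The corkscrew balls then make this integral
  quantitatively large near \<Omega>. The term with the fractional Laplacian of \<beta> has no
  singularity: since \<beta> vanishes in \<Omega>, it is minus \<open>c\<close> times the exterior
  integral of \<open>\<beta> y / dpow s x y\<close>. The two displayed formulas thus differ only by
  regrouping. The logarithm comes from the critical exponent: for |y - z| to the power -n every
  dyadic annulus contributes the same amount, so the integral counts annuli.\<close>

lemma ex_dyadic:
  fixes t :: real
  assumes "1 \<le> t"
  obtains k :: nat where "2 ^ k \<le> t" "t < 2 ^ Suc k" "real k \<le> log 2 t"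
proof
  define k where "k = nat \<lfloor>log 2 t\<rfloor>"
  have "0 \<le> log 2 t" using assms by simp
  then have k: "real k \<le> log 2 t" "log 2 t < real (Suc k)"
    unfolding k_def by linarith+
  then show "real k \<le> log 2 t" by simp
  show "2 ^ k \<le> t"
    using k(1) assms by (simp add: le_log_iff powr_realpow)
  show "t < 2 ^ Suc k"
    using k(2) assms by (simp add: log_less_iff powr_realpow del: of_nat_Suc power_Suc)
qed

text \<open>A substitute for polar coordinates. A radial kernel is dominated by a step function
  built from balls of dyadic radii, and the integral of the latter is a series of ball volumes. Each
  of the three kernel estimates below is an instance with its own series.\<close>

lemma nn_integral_dyadic_sum_le:
  fixes x :: "'a::euclidean_space" and a r :: "nat \<Rightarrow> real" and f :: "'a \<Rightarrow> ennreal"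
  assumes f: "\<And>y. f y \<le> (\<Sum>k. ennreal (a k) * indicator (ball x (r k)) y)"
    and a: "\<And>k. 0 \<le> a k" and r: "\<And>k. 0 \<le> r k"
    and S: "(\<lambda>k. a k * r k ^ DIM('a)) sums S"
  shows "(\<integral>\<^sup>+y. f y \<partial>lborel) \<le> ennreal (unit_ball_vol (real DIM('a)) * S)"
proof -
  have "(\<integral>\<^sup>+y. f y \<partial>lborel) \<le> (\<integral>\<^sup>+y. (\<Sum>k. ennreal (a k) * indicator (ball x (r k)) y) \<partial>lborel)"
    using f by (intro nn_integral_mono)
  also have "\<dots> = (\<Sum>k. ennreal (a k) * emeasure lborel (ball x (r k)))"
    by (subst nn_integral_suminf) (auto simp: nn_integral_cmult_indicator intro!: borel_measurable_times_ennreal borel_measurable_indicator)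
  also have "\<dots> = (\<Sum>k. ennreal (unit_ball_vol (real DIM('a)) * (a k * r k ^ DIM('a))))"
    using a r by (simp add: emeasure_ball ennreal_mult[symmetric] mult_ac)
  also have "\<dots> = ennreal (unit_ball_vol (real DIM('a)) * S)"
    using a r S by (intro suminf_ennreal_eq sums_mult) (auto intro!: mult_nonneg_nonneg)
  finally show ?thesis .
qed

lemma le_suminf_ennreal_term:
  fixes b :: "nat \<Rightarrow> ennreal"
  assumes "c \<le> b k" shows "c \<le> (\<Sum>k. b k)"
proof -
  have "b k = sum b {k}" by simp
  also have "\<dots> \<le> (\<Sum>k. b k)" by (rule sum_le_suminf) auto
  finally show ?thesis using assms by (rule order_trans[rotated])
qed

text \<open>The annulus between radii 2^k r and 2^(k+1) r contributes a multiple of 2^(k(n-p)), a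
  geometric series of ratio \<open>q < 1\<close>. The quantifier order matters: one \<open>K\<close>
  serves all centres \<open>x\<close>, and this makes the later bound on \<open>k_beta\<close>
  uniform in \<open>y\<close>.\<close>

lemma nn_integral_kernel_tail:
  fixes p r :: real
  assumes p: "real DIM('a) < p" and r: "0 < r"
  shows "\<exists>K\<ge>0. \<forall>x::'a::euclidean_space.
    (\<integral>\<^sup>+y. ennreal (norm (x - y) powr - p) * indicator (- ball x r) y \<partial>lborel) \<le> ennreal K"
proof -
  define a where "a k = (2 ^ k * r) powr - p" for k :: nat
  define R where "R k = 2 ^ Suc k * r" for k :: nat
  define q where "q = 2 powr (real DIM('a) - p)"
  have q: "0 < q" "q < 1"
    using p by (auto simp: q_def powr_less_one)
  have "a k * R k ^ DIM('a) = r powr (- p) * (2 * r) ^ DIM('a) * q ^ k" for k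
  proof -
    have "a k = r powr - p * (2 ^ k) powr - p"
      using r by (simp add: a_def powr_mult)
    moreover have "R k ^ DIM('a) = (2 * r) ^ DIM('a) * (2 ^ k) powr real DIM('a)"
      using r by (simp add: R_def powr_realpow power_mult_distrib)
    moreover have "(2 ^ k) powr - p * (2 ^ k) powr real DIM('a) = q ^ k"
      by (simp add: q_def powr_add[symmetric] powr_realpow[symmetric] powr_powr algebra_simps)
    ultimately show ?thesis by (simp add: mult_ac)
  qed
  then have S: "(\<lambda>k. a k * R k ^ DIM('a)) sums (r powr (- p) * (2 * r) ^ DIM('a) * (1 / (1 - q)))"
    by (simp only:) (intro sums_mult geometric_sums, use q in simp)
  have le: "ennreal (norm (x - y) powr - p) * indicator (- ball x r) y
      \<le> (\<Sum>k. ennreal (a k) * indicator (ball x (R k)) y)" for x y :: 'a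
  proof (cases "y \<in> ball x r")
    case False
    then have "1 \<le> norm (x - y) / r" using r by (simp add: dist_norm)
    then obtain k where k: "2 ^ k \<le> norm (x - y) / r" "norm (x - y) / r < 2 ^ Suc k"
      by (rule ex_dyadic)
    have "norm (x - y) powr - p \<le> a k"
      unfolding a_def using k(1) r p by (intro powr_mono2') (auto simp: field_simps)
    moreover have "y \<in> ball x (R k)"
      using k(2) r by (auto simp: R_def dist_norm field_simps)
    ultimately show ?thesis
      by (intro le_suminf_ennreal_term[of _ _ k]) (use False in \<open>auto simp: ennreal_leI indicator_def\<close>)
  qed simp
  show ?thesis
  proof (intro exI conjI allI)
    fix x :: 'a
    show "(\<integral>\<^sup>+y. ennreal (norm (x - y) powr - p) * indicator (- ball x r) y \<partial>lborel)
        \<le> ennreal (unit_ball_vol (real DIM('a)) * (r powr (- p) * (2 * r) ^ DIM('a) * (1 / (1 - q))))"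
      by (rule nn_integral_dyadic_sum_le[OF le _ _ S]) (use r in \<open>auto simp: a_def R_def\<close>)
  qed (use q r in simp)
qed

text \<open>The same dyadic series with annuli shrinking to the singularity; the ratio
  \<open>m = 2 powr (q - n)\<close> is below 1 because the exponent is subcritical.\<close>

lemma nn_integral_kernel_near:
  fixes q r :: real and x :: "'a::euclidean_space"
  assumes q: "0 < q" "q < real DIM('a)" and r: "0 < r"
  shows "(\<integral>\<^sup>+y. ennreal (norm (x - y) powr - q) * indicator (ball x r) y \<partial>lborel) < \<infinity>"
proof -
  define a where "a k = (r / 2 ^ Suc k) powr - q" for k :: nat
  define R where "R k = 2 * r / 2 ^ k" for k :: nat
  define m where "m = 2 powr (q - real DIM('a))"
  have m: "0 < m" "m < 1"
    using q by (auto simp: m_def powr_less_one)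
  have "a k * R k ^ DIM('a) = (r / 2) powr (- q) * (2 * r) ^ DIM('a) * m ^ k" for k
  proof -
    have "a k = ((r / 2) / 2 ^ k) powr - q" by (simp add: a_def mult_ac)
    also have "\<dots> = (r / 2) powr - q * (2 ^ k) powr q"
      using r powr_minus_divide[of "2 ^ k" q] by (subst powr_divide) auto
    finally have "a k = (r / 2) powr - q * (2 ^ k) powr q" .
    moreover have "R k ^ DIM('a) = (2 * r) ^ DIM('a) * (2 ^ k) powr - real DIM('a)"
      using r by (simp add: R_def power_divide powr_minus_divide[of "2 ^ k" "real DIM('a)"] powr_realpow power_mult_distrib)
    moreover have "(2 ^ k) powr q * (2 ^ k) powr - real DIM('a) = m ^ k"
      by (simp add: m_def powr_add[symmetric] powr_realpow[symmetric] powr_powr algebra_simps)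
    ultimately show ?thesis by (simp add: mult_ac)
  qed
  then have S: "(\<lambda>k. a k * R k ^ DIM('a)) sums ((r / 2) powr (- q) * (2 * r) ^ DIM('a) * (1 / (1 - m)))"
    by (simp only:) (intro sums_mult geometric_sums, use m in simp)
  have le: "ennreal (norm (x - y) powr - q) * indicator (ball x r) y
      \<le> (\<Sum>k. ennreal (a k) * indicator (ball x (R k)) y)" for y
  \<comment> \<open>At \<open>y = x\<close> the kernel takes the default value
    \<open>0 powr - q = 0\<close>, so the singular point needs no annulus.\<close>
  proof (cases "y \<in> ball x r \<and> y \<noteq> x")
    case True
    then have d: "0 < norm (x - y)" "norm (x - y) < r" by (auto simp: dist_norm)
    then have "1 \<le> r / norm (x - y)" by simp
    then obtain k where k: "2 ^ k \<le> r / norm (x - y)" "r / norm (x - y) < 2 ^ Suc k"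
      by (rule ex_dyadic)
    have "norm (x - y) powr - q \<le> a k"
    proof -
      have "r < norm (x - y) * 2 ^ Suc k"
        using k(2) d(1) by (simp add: pos_divide_less_eq mult.commute del: power_Suc)
      then have "0 < r / 2 ^ Suc k" "r / 2 ^ Suc k \<le> norm (x - y)"
        using r by (simp_all add: pos_divide_le_eq del: power_Suc)
      then show ?thesis unfolding a_def using q by (intro powr_mono2') auto
    qed
    \<comment> \<open>Equality can occur here while the balls are open; this is the reason for the
      factor 2 in \<open>R k\<close>.\<close>
    moreover have "norm (x - y) * 2 ^ k \<le> r" using k(1) d by (simp add: field_simps)
    then have "norm (x - y) * 2 ^ k < 2 * r" using r by linarith
    then have "y \<in> ball x (R k)"
      by (auto simp: R_def dist_norm field_simps)
    ultimately show ?thesis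
      by (intro le_suminf_ennreal_term[of _ _ k]) (use True in \<open>auto simp: ennreal_leI\<close>)
  qed auto
  have "(\<integral>\<^sup>+y. ennreal (norm (x - y) powr - q) * indicator (ball x r) y \<partial>lborel)
      \<le> ennreal (unit_ball_vol (real DIM('a)) *
          ((r / 2) powr (- q) * (2 * r) ^ DIM('a) * (1 / (1 - m))))"
    by (rule nn_integral_dyadic_sum_le[OF le _ _ S]) (use r in \<open>auto simp: a_def R_def\<close>)
  then show ?thesis by (rule order_le_less_trans) simp
qed

text \<open>At the critical exponent the dyadic terms are constant, so the bound is that constant
  times the number of annuli between \<delta> and \<open>R\<close>, which is of order
  \<open>log 2 (R / \<delta>)\<close>. The constant \<open>L\<close> absorbs \<open>log 2 R\<close>
  and the change to the natural logarithm.\<close>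

lemma nn_integral_kernel_log:
  fixes R :: real
  assumes R: "0 < R"
  shows "\<exists>K\<ge>0. \<forall>(x::'a::euclidean_space) \<delta>. 0 < \<delta> \<longrightarrow>
    (\<integral>\<^sup>+y. ennreal (norm (x - y) powr - real DIM('a)) * indicator {y. \<delta> \<le> norm (x - y) \<and> norm (x - y) \<le> R} y \<partial>lborel)
      \<le> ennreal (K * (1 + \<bar>ln \<delta>\<bar>))"
proof -
  define n where "n = DIM('a)"
  define V where "V = unit_ball_vol (real n) * 2 ^ n"
  define L where "L = 1 + \<bar>log 2 R\<bar> + 1 / ln 2"
  have V: "0 \<le> V" by (simp add: V_def)
  have L: "0 \<le> L" "1 + \<bar>log 2 R\<bar> \<le> L" "1 / ln 2 \<le> L" by (auto simp: L_def)
  have "(\<integral>\<^sup>+y. ennreal (norm (x - y) powr - real DIM('a)) * indicator {y. \<delta> \<le> norm (x - y) \<and> norm (x - y) \<le> R} y \<partial>lborel)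
      \<le> ennreal (V * L * (1 + \<bar>ln \<delta>\<bar>))" (is "?I \<le> _")
    if \<delta>: "0 < \<delta>" for x :: 'a and \<delta>
  proof (cases "\<delta> \<le> R")
    case False
    then have "{y. \<delta> \<le> norm (x - y) \<and> norm (x - y) \<le> R} = {}" by auto
    then have "?I = 0" by simp
    then show ?thesis by simp
  next
    case True
    \<comment> \<open>The annuli are numbered from 0 to \<open>M\<close>, hence
      \<open>1 + real M\<close> terms; the weights \<open>a k\<close> vanish beyond \<open>M\<close>
      to make the series finite.\<close>
    define M where "M = nat \<lfloor>log 2 (R / \<delta>)\<rfloor>"
    define a where "a k = (if k \<le> M then (2 ^ k * \<delta>) powr - real n else 0)" for k :: nat
    define r where "r k = 2 ^ Suc k * \<delta>" for k :: nat
    have "a k * r k ^ n = (if k \<in> {..M} then 2 ^ n else 0)" for k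
      using \<delta> by (auto simp: a_def r_def powr_minus powr_realpow field_simps)
    then have S: "(\<lambda>k. a k * r k ^ n) sums (\<Sum>k\<in>{..M}. 2 ^ n)"
      using sums_If_finite_set[of "{..M}" "\<lambda>_. 2 ^ n :: real"] by simp
    have le: "ennreal (norm (x - y) powr - real DIM('a)) * indicator {y. \<delta> \<le> norm (x - y) \<and> norm (x - y) \<le> R} y
        \<le> (\<Sum>k. ennreal (a k) * indicator (ball x (r k)) y)" for y
    proof (cases "\<delta> \<le> norm (x - y) \<and> norm (x - y) \<le> R")
      case T: True
      then have "1 \<le> norm (x - y) / \<delta>" using \<delta> by simp
      then obtain k where k: "2 ^ k \<le> norm (x - y) / \<delta>" "norm (x - y) / \<delta> < 2 ^ Suc k"
        "real k \<le> log 2 (norm (x - y) / \<delta>)"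
        by (rule ex_dyadic)
      have "log 2 (norm (x - y) / \<delta>) \<le> log 2 (R / \<delta>)"
        using T \<delta> R \<open>1 \<le> norm (x - y) / \<delta>\<close>
        by (subst log_le_cancel_iff) (auto simp del: le_divide_eq_1_pos intro: divide_right_mono)
      then have "k \<le> M" using k(3) unfolding M_def by linarith
      have "norm (x - y) powr - real DIM('a) \<le> a k"
        using k(1) \<delta> \<open>k \<le> M\<close> by (auto simp: n_def field_simps a_def intro!: powr_mono2')
      moreover have "y \<in> ball x (r k)"
        using k(2) \<delta> by (auto simp: r_def dist_norm field_simps)
      ultimately show ?thesis
        by (intro le_suminf_ennreal_term[of _ _ k]) (use T in \<open>auto simp: ennreal_leI\<close>)
    qed auto
    have "?I \<le> ennreal (unit_ball_vol (real DIM('a)) * (\<Sum>k\<in>{..M}. 2 ^ n))"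
      using S[unfolded n_def] \<delta> unfolding n_def
      by (intro nn_integral_dyadic_sum_le[OF le]) (auto simp: a_def r_def n_def)
    also have "unit_ball_vol (real DIM('a)) * (\<Sum>k\<in>{..M}. 2 ^ n) = V * (1 + real M)"
      by (simp add: V_def n_def)
    also have "1 + real M \<le> L * (1 + \<bar>ln \<delta>\<bar>)"
    proof -
      have "0 \<le> log 2 (R / \<delta>)" using True \<delta> by simp
      then have "real M \<le> log 2 (R / \<delta>)" unfolding M_def by linarith
      also have "\<dots> = log 2 R - ln \<delta> / ln 2"
        using R \<delta> by (simp add: log_def ln_div diff_divide_distrib)
      also have "\<dots> \<le> \<bar>log 2 R\<bar> + 1 / ln 2 * \<bar>ln \<delta>\<bar>"
      proof -
        have "- (ln \<delta> / ln 2) \<le> \<bar>ln \<delta>\<bar> / ln 2"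
          by (metis abs_ge_minus_self abs_divide abs_of_pos ln_gt_zero one_less_numeral_iff semiring_norm(76))
        then show ?thesis by simp
      qed
      also have "\<dots> \<le> \<bar>log 2 R\<bar> + L * \<bar>ln \<delta>\<bar>"
        using L(3) by (intro add_left_mono mult_right_mono) auto
      finally show ?thesis using L(2) by (simp add: algebra_simps)
    qed
    then have "V * (1 + real M) \<le> V * (L * (1 + \<bar>ln \<delta>\<bar>))"
      using V by (intro mult_left_mono) auto
    finally show ?thesis by (simp add: mult.assoc ennreal_leI order_trans)
  qed
  then show ?thesis using V L by (intro exI[of _ "V * L"]) auto
qed

section \<open>Taylor expansion of Hoelder functions\<close>

lemma Ck_holder_loc_continuous_on:
  "Ck_holder_loc k \<theta> U f \<Longrightarrow> continuous_on U f"
proof (cases k)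
  case (Suc j)
  assume "Ck_holder_loc k \<theta> U f"
  then have "f differentiable_on U"
    unfolding Suc Ck_holder_loc.simps differentiable_on_def by (blast intro: differentiable_at_withinI)
  then show ?thesis by (rule differentiable_imp_continuous_on)
qed simp

lemma frechet_derivative_eq_inner:
  fixes f :: "'a::euclidean_space \<Rightarrow> real"
  assumes "f differentiable (at x)"
  shows "frechet_derivative f (at x) h = h \<bullet> (\<Sum>i\<in>Basis. frechet_derivative f (at x) i *\<^sub>R i)"
proof -
  interpret linear "frechet_derivative f (at x)"
    using assms by (rule linear_frechet_derivative)
  have "frechet_derivative f (at x) h = frechet_derivative f (at x) (\<Sum>i\<in>Basis. (h \<bullet> i) *\<^sub>R i)"
    by (simp add: euclidean_representation)
  also have "\<dots> = (\<Sum>i\<in>Basis. (h \<bullet> i) * frechet_derivative f (at x) i)"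
    by (simp add: sum scale)
  finally show ?thesis by (simp add: inner_sum_right mult_ac)
qed

lemma norm_sum_Basis_le:
  "norm (\<Sum>i\<in>Basis. c i *\<^sub>R i :: 'a::euclidean_space) \<le> (\<Sum>i\<in>Basis. \<bar>c i\<bar>)"
  by (rule order_trans[OF norm_sum]) simp

lemma onorm_inner_le:
  fixes v :: "'a::real_inner"
  assumes "norm v \<le> B"
  shows "onorm (\<lambda>h. h \<bullet> v) \<le> B"
proof (rule onorm_bound)
  show "0 \<le> B" using assms norm_ge_zero order_trans by blast
  fix h
  have "\<bar>h \<bullet> v\<bar> \<le> norm h * norm v" by (rule Cauchy_Schwarz_ineq2)
  also have "\<dots> \<le> B * norm h" using assms mult_right_mono[OF assms, of "norm h"] by (simp add: mult.commute)
  finally show "norm (h \<bullet> v) \<le> B * norm h" by simp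
qed

text \<open>Continuous partial derivatives are bounded on the compact ball, and the mean value
  inequality does the rest. It serves both the gradient of \<open>u\<close> for orders at least 2
  and the graph function of the boundary.\<close>

lemma Ck_holder_loc_Suc_lipschitz:
  fixes f :: "'a::euclidean_space \<Rightarrow> real"
  assumes f: "Ck_holder_loc (Suc k) \<theta> U f" and U: "cball x r \<subseteq> U"
  obtains L where "0 \<le> L" "\<And>y z. y \<in> cball x r \<Longrightarrow> z \<in> cball x r \<Longrightarrow> \<bar>f y - f z\<bar> \<le> L * norm (y - z)"
proof -
  let ?D = "\<lambda>y. frechet_derivative f (at y)"
  have "\<forall>i\<in>Basis. \<exists>B. \<forall>y\<in>cball x r. \<bar>?D y i\<bar> \<le> B"
  proof
    fix i :: 'a assume i: "i \<in> Basis"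
    have "continuous_on U (\<lambda>y. ?D y i)"
      using f i unfolding Ck_holder_loc.simps(2) by (blast intro: Ck_holder_loc_continuous_on)
    then have "compact ((\<lambda>y. ?D y i) ` cball x r)"
      by (intro compact_continuous_image compact_cball) (rule continuous_on_subset[OF _ U])
    then show "\<exists>B. \<forall>y\<in>cball x r. \<bar>?D y i\<bar> \<le> B"
      by (auto dest!: compact_imp_bounded simp: bounded_real)
  qed
  then obtain B where B: "\<And>i y. i \<in> Basis \<Longrightarrow> y \<in> cball x r \<Longrightarrow> \<bar>?D y i\<bar> \<le> B i"
    by metis
  show thesis
  proof
    show "0 \<le> (\<Sum>i\<in>Basis. \<bar>B i\<bar>)" by (simp add: sum_nonneg)
    fix y z assume yz: "y \<in> cball x r" "z \<in> cball x r"
    have "norm (f y - f z) \<le> (\<Sum>i\<in>Basis. \<bar>B i\<bar>) * norm (y - z)"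
    proof (rule differentiable_bound[OF convex_cball _ _ yz])
      fix w assume w: "w \<in> cball x r"
      then have d: "f differentiable (at w)" using f U unfolding Ck_holder_loc.simps(2) by blast
      then show "(f has_derivative ?D w) (at w within cball x r)"
        by (metis frechet_derivative_works has_derivative_at_withinI)
      have "norm (\<Sum>i\<in>Basis. ?D w i *\<^sub>R i) \<le> (\<Sum>i\<in>Basis. \<bar>B i\<bar>)"
        using B[OF _ w] by (intro order_trans[OF norm_sum_Basis_le] sum_mono) fastforce
      then show "onorm (?D w) \<le> (\<Sum>i\<in>Basis. \<bar>B i\<bar>)"
        by (subst frechet_derivative_eq_inner[OF d, abs_def]) (rule onorm_inner_le)
    qed
    then show "\<bar>f y - f z\<bar> \<le> (\<Sum>i\<in>Basis. \<bar>B i\<bar>) * norm (y - z)" by simp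
  qed
qed

text \<open>After subtracting the linear part, this is the mean value inequality on the segment from
  \<open>x\<close> to \<open>y\<close>: every point \<open>w\<close> of it satisfies |w - x| \<le>
  |x - y|, which controls the change of the gradient.\<close>

lemma first_order_taylor:
  fixes f :: "'a::euclidean_space \<Rightarrow> real"
  assumes d: "\<And>y. y \<in> cball x r \<Longrightarrow> f differentiable (at y)"
    and h: "\<And>i y. i \<in> Basis \<Longrightarrow> y \<in> cball x r \<Longrightarrow>
      \<bar>frechet_derivative f (at y) i - frechet_derivative f (at x) i\<bar> \<le> C i * norm (y - x) powr \<theta>"
    and C: "\<And>i. i \<in> Basis \<Longrightarrow> 0 \<le> C i" and \<theta>: "0 \<le> \<theta>" and y: "y \<in> cball x r"
  shows "\<bar>f x - f y - (x - y) \<bullet> (\<Sum>i\<in>Basis. frechet_derivative f (at x) i *\<^sub>R i)\<bar>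
    \<le> (\<Sum>i\<in>Basis. C i) * norm (x - y) powr (1 + \<theta>)"
proof (cases "x = y")
  case False
  let ?D = "\<lambda>y. frechet_derivative f (at y)"
  let ?a = "\<lambda>y. \<Sum>i\<in>Basis. frechet_derivative f (at y) i *\<^sub>R i"
  let ?S = "closed_segment x y"
  have xr: "x \<in> cball x r" using y by (simp add: order_trans[OF zero_le_dist])
  have S: "w \<in> cball x r" "norm (w - x) \<le> norm (x - y)" if "w \<in> ?S" for w
    using that y segment_bound[of w x y] by (auto simp: dist_norm norm_minus_commute)
  have "norm ((f x - x \<bullet> ?a x) - (f y - y \<bullet> ?a x))
      \<le> ((\<Sum>i\<in>Basis. C i) * norm (x - y) powr \<theta>) * norm (x - y)"
  proof (rule differentiable_bound[of ?S _ "\<lambda>w h. h \<bullet> (?a w - ?a x)"])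
    fix w assume w: "w \<in> ?S"
    have "(f has_derivative (\<lambda>h. h \<bullet> ?a w)) (at w)"
      using d[OF S(1)[OF w]] 
      by (subst frechet_derivative_eq_inner[symmetric]) (simp_all add: frechet_derivative_works[symmetric])
    then show "((\<lambda>w. f w - w \<bullet> ?a x) has_derivative (\<lambda>h. h \<bullet> (?a w - ?a x))) (at w within ?S)"
      unfolding inner_diff_right
      by (rule has_derivative_at_withinI[OF has_derivative_diff[OF _ has_derivative_inner_left[OF has_derivative_ident]]])
    have "norm (?a w - ?a x) = norm (\<Sum>i\<in>Basis. (?D w i - ?D x i) *\<^sub>R i)"
      by (simp add: sum_subtractf scaleR_diff_left)
    also have "\<dots> \<le> (\<Sum>i\<in>Basis. \<bar>?D w i - ?D x i\<bar>)" by (rule norm_sum_Basis_le)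
    also have "\<dots> \<le> (\<Sum>i\<in>Basis. C i * norm (x - y) powr \<theta>)"
    proof (rule sum_mono)
      fix i :: 'a assume i: "i \<in> Basis"
      have "\<bar>?D w i - ?D x i\<bar> \<le> C i * norm (w - x) powr \<theta>" using h[OF i S(1)[OF w]] .
      also have "\<dots> \<le> C i * norm (x - y) powr \<theta>"
        using S(2)[OF w] C[OF i] \<theta> by (intro mult_left_mono powr_mono2) auto
      finally show "\<bar>?D w i - ?D x i\<bar> \<le> C i * norm (x - y) powr \<theta>" .
    qed
    finally show "onorm (\<lambda>h. h \<bullet> (?a w - ?a x)) \<le> (\<Sum>i\<in>Basis. C i) * norm (x - y) powr \<theta>"
      by (intro onorm_inner_le) (simp add: sum_distrib_right)
  qed auto
  then show ?thesis
    using False by (simp add: inner_diff_left powr_add algebra_simps)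
qed simp

text \<open>The exponent is capped at \<open>2\<close> because for \<open>\<gamma> \<ge> 2\<close> only a Lipschitz gradient is used.\<close>

lemma holder_loc_taylor:
  fixes f :: "'a::euclidean_space \<Rightarrow> real"
  assumes f: "holder_loc \<gamma> U f" and \<gamma>: "0 < \<gamma>" and r: "0 \<le> r" and U: "cball x r \<subseteq> U"
  obtains C a where "0 \<le> C"
    "\<And>y. y \<in> cball x r \<Longrightarrow> \<bar>f x - f y - (x - y) \<bullet> a\<bar> \<le> C * norm (x - y) powr min \<gamma> 2"
proof -
  have xr: "x \<in> cball x r" using r by simp
  consider "nat \<lfloor>\<gamma>\<rfloor> = 0" | "nat \<lfloor>\<gamma>\<rfloor> = 1" | k where "nat \<lfloor>\<gamma>\<rfloor> = Suc (Suc k)"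
    by (metis One_nat_def not0_implies_Suc)
  then show thesis
  proof cases
    case 1
    then have g: "frac \<gamma> = \<gamma>" "\<gamma> < 1" using \<gamma> by (auto simp: frac_def floor_eq_iff)
    have "Ck_holder_loc 0 \<gamma> U f" using f 1 g by (simp add: holder_loc_def)
    then obtain C where C: "\<forall>y\<in>cball x r. \<forall>z\<in>cball x r. \<bar>f y - f z\<bar> \<le> C * norm (y - z) powr \<gamma>"
      unfolding Ck_holder_loc.simps using U compact_cball[of x r] by blast
    \<comment> \<open>Below order 1 the Hoelder bound is already the claim, with zero linear
      term.\<close>
    show thesis
    proof (rule that[of "\<bar>C\<bar>" 0])
      fix y assume "y \<in> cball x r"
      then have "\<bar>f x - f y\<bar> \<le> C * norm (x - y) powr \<gamma>" using C xr by blast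
      also have "\<dots> \<le> \<bar>C\<bar> * norm (x - y) powr \<gamma>" by (intro mult_right_mono) auto
      finally show "\<bar>f x - f y - (x - y) \<bullet> 0\<bar> \<le> \<bar>C\<bar> * norm (x - y) powr min \<gamma> 2"
        using g by (simp add: min_def)
    qed simp
  next
    case 2
    then have g: "frac \<gamma> = \<gamma> - 1" "min \<gamma> 2 = 1 + (\<gamma> - 1)" "0 \<le> \<gamma> - 1"
      by (auto simp: frac_def) linarith+
    have "\<forall>i\<in>Basis. \<exists>C. \<forall>y\<in>cball x r. \<forall>z\<in>cball x r.
        \<bar>frechet_derivative f (at y) i - frechet_derivative f (at z) i\<bar> \<le> C * norm (y - z) powr (\<gamma> - 1)"
      using f 2 g U by (auto simp: holder_loc_def)
    then obtain C where C: "\<And>i y z. i \<in> Basis \<Longrightarrow> y \<in> cball x r \<Longrightarrow> z \<in> cball x r \<Longrightarrow>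
        \<bar>frechet_derivative f (at y) i - frechet_derivative f (at z) i\<bar> \<le> C i * norm (y - z) powr (\<gamma> - 1)"
      by metis
    have d: "\<And>y. y \<in> cball x r \<Longrightarrow> f differentiable (at y)"
      using f 2 U by (auto simp: holder_loc_def)
    show thesis
    proof (rule that)
      show "0 \<le> (\<Sum>i\<in>(Basis::'a set). \<bar>C i\<bar>)" by (simp add: sum_nonneg)
      fix y assume y: "y \<in> cball x r"
      show "\<bar>f x - f y - (x - y) \<bullet> (\<Sum>i\<in>Basis. frechet_derivative f (at x) i *\<^sub>R i)\<bar>
          \<le> (\<Sum>i\<in>Basis. \<bar>C i\<bar>) * norm (x - y) powr min \<gamma> 2"
        unfolding g(2)
        by (rule first_order_taylor[OF d _ _ g(3) y])
          (auto intro!: order_trans[OF C[OF _ _ xr]] mult_right_mono simp del: mem_cball)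
    qed
  next
    case 3
    then have g: "min \<gamma> 2 = 1 + 1" by (auto simp: min_def) linarith
    have "\<forall>i\<in>Basis. \<exists>C\<ge>0. \<forall>y\<in>cball x r. \<forall>z\<in>cball x r.
        \<bar>frechet_derivative f (at y) i - frechet_derivative f (at z) i\<bar> \<le> C * norm (y - z)"
    proof
      fix i :: 'a assume "i \<in> Basis"
      \<comment> \<open>The first partial derivatives are still continuously differentiable, hence
        Lipschitz on the ball: a Hoelder exponent 1 for the gradient, and \<open>1 + 1\<close> for
        the remainder.\<close>
      then have "Ck_holder_loc (Suc k) (frac \<gamma>) U (\<lambda>y. frechet_derivative f (at y) i)"
        using f 3 by (simp add: holder_loc_def del: Ck_holder_loc.simps) (simp only: Ck_holder_loc.simps(2)[of "Suc k"])
      then show "\<exists>C\<ge>0. \<forall>y\<in>cball x r. \<forall>z\<in>cball x r.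
        \<bar>frechet_derivative f (at y) i - frechet_derivative f (at z) i\<bar> \<le> C * norm (y - z)"
        using Ck_holder_loc_Suc_lipschitz[OF _ U] by metis
    qed
    then obtain C where C: "\<And>i. i \<in> Basis \<Longrightarrow> 0 \<le> C i"
      "\<And>i y z. i \<in> Basis \<Longrightarrow> y \<in> cball x r \<Longrightarrow> z \<in> cball x r \<Longrightarrow>
        \<bar>frechet_derivative f (at y) i - frechet_derivative f (at z) i\<bar> \<le> C i * norm (y - z)"
      by metis
    have d: "\<And>y. y \<in> cball x r \<Longrightarrow> f differentiable (at y)"
      using f 3 U by (auto simp: holder_loc_def)
    show thesis
    proof (rule that)
      show "0 \<le> (\<Sum>i\<in>(Basis::'a set). C i)" by (simp add: sum_nonneg C)
      fix y assume y: "y \<in> cball x r"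
      show "\<bar>f x - f y - (x - y) \<bullet> (\<Sum>i\<in>Basis. frechet_derivative f (at x) i *\<^sub>R i)\<bar>
          \<le> (\<Sum>i\<in>Basis. C i) * norm (x - y) powr min \<gamma> 2"
        unfolding g
        by (rule first_order_taylor[OF d _ C(1) _ y]) (use C(2)[OF _ _ xr] in auto)
    qed
  qed
qed

section \<open>Geometry of the boundary\<close>

lemma norm_orthogonal_projection_le:
  fixes e w :: "'a::real_inner"
  assumes "norm e = 1"
  shows "norm (w - (w \<bullet> e) *\<^sub>R e) \<le> norm w"
proof -
  have "e \<bullet> e = 1" using assms by (simp add: norm_eq_1)
  then have "(w - (w \<bullet> e) *\<^sub>R e) \<bullet> (w - (w \<bullet> e) *\<^sub>R e) = w \<bullet> w - (w \<bullet> e) * (w \<bullet> e)"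
    by (simp add: inner_diff_left inner_diff_right inner_commute[of e w])
  also have "\<dots> \<le> w \<bullet> w" by simp
  finally show ?thesis by (simp only: norm_le)
qed

text \<open>A frontier point of the open set \<Omega> is not in \<Omega>, so it is not strictly
  above the graph. Nor is it strictly below, since the points strictly below form an open set that
  misses \<Omega> inside the ball.\<close>

lemma frontier_on_graph:
  fixes \<Omega> :: "'a::euclidean_space set" and g :: "'a \<Rightarrow> real"
  assumes \<Omega>: "open \<Omega>" and g: "continuous_on UNIV g" 
    and eq: "\<Omega> \<inter> ball p r = {x \<in> ball p r. x \<bullet> e > g (x - (x \<bullet> e) *\<^sub>R e)}"
    and q: "q \<in> frontier \<Omega>" "q \<in> ball p r"
  shows "q \<bullet> e = g (q - (q \<bullet> e) *\<^sub>R e)"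
proof -
  let ?h = "\<lambda>x. x \<bullet> e - g (x - (x \<bullet> e) *\<^sub>R e)"
  have "q \<notin> \<Omega>" using q \<Omega> by (simp add: frontier_def interior_open)
  then have "q \<notin> {x \<in> ball p r. x \<bullet> e > g (x - (x \<bullet> e) *\<^sub>R e)}"
    unfolding eq[symmetric] by blast
  then have "?h q \<le> 0" using q(2) by simp
  moreover have "\<not> ?h q < 0"
  proof
    assume "?h q < 0"
    have "continuous_on UNIV ?h"
      by (intro continuous_on_diff continuous_on_compose2[OF g, where f = "\<lambda>x. x - (x \<bullet> e) *\<^sub>R e"])
        (auto intro!: continuous_intros)
    then have "open {x. ?h x < 0}" by (rule open_Collect_less) (rule continuous_on_const)
    then have "open ({x. ?h x < 0} \<inter> ball p r)" by auto
    moreover have "q \<in> {x. ?h x < 0} \<inter> ball p r" using \<open>?h q < 0\<close> q by auto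
    moreover have "{x. ?h x < 0} \<inter> ball p r \<inter> \<Omega> = {x. ?h x < 0} \<inter> (\<Omega> \<inter> ball p r)" by blast
    then have "{x. ?h x < 0} \<inter> ball p r \<inter> \<Omega> = {}" unfolding eq by auto
    ultimately have "q \<notin> closure \<Omega>"
      using open_Int_closure_eq_empty by blast
    then show False using q by (simp add: frontier_def)
  qed
  ultimately show ?thesis by simp
qed

text \<open>Near each of its points the frontier lies in the image of a hyperplane under the
  differentiable map \<open>y + g y *\<^sub>R e\<close> from the space to itself, and such maps send
  null sets to null sets.\<close>

lemma negligible_frontier_C11:
  fixes \<Omega> :: "'a::euclidean_space set"
  assumes \<Omega>: "open \<Omega>" and b: "C11_boundary \<Omega>"
  shows "negligible (frontier \<Omega>)"
proof (rule locally_negligible_alt[THEN iffD2], rule ballI)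
  fix p assume p: "p \<in> frontier \<Omega>"
  from bspec[OF b[unfolded C11_boundary_def] p]
  obtain r e g where r: "0 < r" and e: "norm e = 1" and g: "Ck_holder_loc 1 1 UNIV g"
    and eq: "\<Omega> \<inter> ball p r = {x \<in> ball p r. x \<bullet> e > g (x - (x \<bullet> e) *\<^sub>R e)}"
    by (elim exE conjE) (rule that)
  let ?H = "{y. e \<bullet> y = 0}"
  have "negligible ?H" using e by (intro negligible_hyperplane) auto
  moreover have "(\<lambda>y. y + g y *\<^sub>R e) differentiable_on ?H"
    unfolding differentiable_on_def
  proof (rule ballI, rule differentiable_at_withinI)
    fix y
    have "g differentiable (at y)" using g by simp
    then show "(\<lambda>y. y + g y *\<^sub>R e) differentiable (at y)"
      by (rule differentiable_add[OF differentiable_ident differentiable_scaleR[OF _ differentiable_const]])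
  qed
  ultimately have neg: "negligible ((\<lambda>y. y + g y *\<^sub>R e) ` ?H)"
    by (rule negligible_differentiable_image_negligible[OF order_refl])
  have "frontier \<Omega> \<inter> ball p r \<subseteq> (\<lambda>y. y + g y *\<^sub>R e) ` ?H"
  proof
    fix q assume "q \<in> frontier \<Omega> \<inter> ball p r"
    then have "q \<bullet> e = g (q - (q \<bullet> e) *\<^sub>R e)"
      by (intro frontier_on_graph[OF \<Omega> Ck_holder_loc_continuous_on[OF g] eq]) simp_all
    then have "q = (q - (q \<bullet> e) *\<^sub>R e) + g (q - (q \<bullet> e) *\<^sub>R e) *\<^sub>R e" by simp
    moreover have "q - (q \<bullet> e) *\<^sub>R e \<in> ?H"
      using e by (simp add: inner_diff_right inner_commute norm_eq_1)
    ultimately show "q \<in> (\<lambda>y. y + g y *\<^sub>R e) ` ?H" by (rule image_eqI)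
  qed
  with neg have "negligible (frontier \<Omega> \<inter> ball p r)" by (rule negligible_subset)
  then show "\<exists>U. openin (top_of_set (frontier \<Omega>)) U \<and> p \<in> U \<and> negligible U"
    using p r by (intro exI[of _ "frontier \<Omega> \<inter> ball p r"] conjI openin_open_Int) auto
qed

text \<open>Going from \<open>q\<close> up by \<rho>/2 in direction \<open>e\<close> leaves vertical
  room above the graph, and the Lipschitz bound on \<open>g\<close> limits how much of it the graph
  can consume over a small ball.\<close>

lemma C11_corkscrew_local:
  fixes \<Omega> :: "'a::euclidean_space set"
  assumes \<Omega>: "open \<Omega>" and b: "C11_boundary \<Omega>" and p: "p \<in> frontier \<Omega>"
  shows "\<exists>\<kappa>>0. \<exists>r>0. \<forall>q\<in>frontier \<Omega> \<inter> ball p r. \<forall>\<rho>. 0 < \<rho> \<and> \<rho> \<le> r \<longrightarrow>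
    (\<exists>a. ball a (\<kappa> * \<rho>) \<subseteq> \<Omega> \<inter> ball q \<rho>)"
proof -
  from bspec[OF b[unfolded C11_boundary_def] p]
  obtain r e g where r: "0 < r" and e: "norm e = 1" and g: "Ck_holder_loc 1 1 UNIV g"
    and eq: "\<Omega> \<inter> ball p r = {x \<in> ball p r. x \<bullet> e > g (x - (x \<bullet> e) *\<^sub>R e)}"
    by (elim exE conjE) (rule that)
  define P where "P x = x - (x \<bullet> e) *\<^sub>R e" for x
  have P_diff: "P x - P y = P (x - y)" for x y by (simp add: P_def inner_diff_left algebra_simps)
  have P_le: "norm (P x) \<le> norm x" for x
    unfolding P_def by (rule norm_orthogonal_projection_le[OF e])
  obtain L where L: "0 \<le> L"
    "\<And>y z. y \<in> cball (P p) r \<Longrightarrow> z \<in> cball (P p) r \<Longrightarrow> \<bar>g y - g z\<bar> \<le> L * norm (y - z)"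
    using Ck_holder_loc_Suc_lipschitz[of 0 1 UNIV g "P p" r] g by auto
  \<comment> \<open>Chosen so that \<open>1 / 2 - \<kappa> = L * \<kappa>\<close>: over the ball of
    radius \<open>\<kappa> * \<rho>\<close> the graph rises by less than the height that remains at
    the lowest points of the ball. Also \<kappa> \<le> 1/2 keeps this ball inside
    \<open>ball q \<rho>\<close>.\<close>
  define \<kappa> where "\<kappa> = 1 / (2 * (1 + L))"
  have \<kappa>: "0 < \<kappa>" "\<kappa> \<le> 1 / 2" "1 / 2 - \<kappa> = L * \<kappa>"
    using L(1) by (auto simp: \<kappa>_def field_simps)
  have P_in: "P x \<in> cball (P p) r" if "x \<in> ball p r" for x
    using that P_le[of "p - x"] by (simp add: dist_norm P_diff)
  \<comment> \<open>Both radii are halved so that the whole ball stays in \<open>ball p r\<close>,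
    where \<Omega> is described by \<open>g\<close>.\<close>
  have "ball (q + (\<rho> / 2) *\<^sub>R e) (\<kappa> * \<rho>) \<subseteq> \<Omega> \<inter> ball q \<rho>"
    if q: "q \<in> frontier \<Omega>" "q \<in> ball p (r / 2)" and \<rho>: "0 < \<rho>" "\<rho> \<le> r / 2" for q \<rho>
  proof
    fix z assume z: "z \<in> ball (q + (\<rho> / 2) *\<^sub>R e) (\<kappa> * \<rho>)"
    define w where "w = z - q - (\<rho> / 2) *\<^sub>R e"
    have w: "norm w < \<kappa> * \<rho>" using z by (simp add: w_def dist_norm norm_minus_commute algebra_simps)
    have zq: "z - q = (\<rho> / 2) *\<^sub>R e + w" by (simp add: w_def)
    have "norm (z - q) \<le> \<rho> / 2 + norm w"
      unfolding zq using e \<rho> by (intro norm_triangle_le) auto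
    also have "\<dots> < \<rho> / 2 + \<kappa> * \<rho>" using w by simp
    also have "\<dots> \<le> \<rho>" using mult_right_mono[OF \<kappa>(2), of \<rho>] \<rho> by linarith
    finally have zq\<rho>: "norm (z - q) < \<rho>" .
    have q': "q \<in> ball p r" using q(2) r by auto
    have "dist p z \<le> dist p q + dist q z" by (rule dist_triangle)
    also have "\<dots> < r" using q(2) zq\<rho> \<rho> by (simp add: dist_norm norm_minus_commute)
    finally have z': "z \<in> ball p r" by simp
    have "P z - P q = P w" unfolding P_diff zq using e
      by (simp add: P_def inner_add_left norm_eq_1 algebra_simps)
    then have "\<bar>g (P z) - g (P q)\<bar> \<le> L * norm (P w)"
      using L(2)[OF P_in[OF z'] P_in[OF q']] by simp
    also have "\<dots> \<le> L * norm w" using L(1) P_le by (intro mult_left_mono) auto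
    also have "\<dots> \<le> L * \<kappa> * \<rho>" using L(1) w by (simp add: mult.assoc mult_left_mono)
    also have "L * \<kappa> * \<rho> = \<rho> / 2 - \<kappa> * \<rho>"
      unfolding \<kappa>(3)[symmetric] by (simp add: algebra_simps)
    finally have gP: "g (P z) \<le> g (P q) + (\<rho> / 2 - \<kappa> * \<rho>)" by linarith
    have "z \<bullet> e - q \<bullet> e = \<rho> / 2 + w \<bullet> e"
      using arg_cong[OF zq, of "\<lambda>v. v \<bullet> e"] e
      by (simp add: inner_add_left inner_diff_left norm_eq_1)
    moreover have "- norm w \<le> w \<bullet> e"
      using Cauchy_Schwarz_ineq2[of w e] e by simp
    moreover have "q \<bullet> e = g (P q)"
      unfolding P_def by (rule frontier_on_graph[OF \<Omega> Ck_holder_loc_continuous_on[OF g] eq q(1) q'])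
    ultimately have "g (P z) < z \<bullet> e" using gP w by linarith
    then have "z \<in> {x \<in> ball p r. x \<bullet> e > g (x - (x \<bullet> e) *\<^sub>R e)}" using z' by (simp add: P_def)
    then have "z \<in> \<Omega>" unfolding eq[symmetric] by blast
    then show "z \<in> \<Omega> \<inter> ball q \<rho>" using zq\<rho> by (simp add: dist_norm norm_minus_commute)
  qed
  then show ?thesis using r \<kappa>(1)
    by (intro exI[of _ \<kappa>] conjI exI[of _ "r / 2"]) (simp, simp, blast)
qed

text \<open>The frontier is compact, so finitely many local constants suffice. Their minima still
  work: a smaller \<kappa> shrinks the ball and a smaller \<open>r\<close> restricts \<rho>.\<close>

lemma C11_corkscrew:
  fixes \<Omega> :: "'a::euclidean_space set"
  assumes \<Omega>: "open \<Omega>" "bounded \<Omega>" and b: "C11_boundary \<Omega>"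
  obtains \<kappa> r where "0 < \<kappa>" "0 < r"
    "\<And>q \<rho>. q \<in> frontier \<Omega> \<Longrightarrow> 0 < \<rho> \<Longrightarrow> \<rho> \<le> r \<Longrightarrow> \<exists>a. ball a (\<kappa> * \<rho>) \<subseteq> \<Omega> \<inter> ball q \<rho>"
proof -
  define good where "good p \<kappa> r \<longleftrightarrow> (\<forall>q\<in>frontier \<Omega> \<inter> ball p r. \<forall>\<rho>. 0 < \<rho> \<and> \<rho> \<le> r \<longrightarrow>
    (\<exists>a. ball a (\<kappa> * \<rho>) \<subseteq> \<Omega> \<inter> ball q \<rho>))" for p \<kappa> r
  have "\<forall>p\<in>frontier \<Omega>. \<exists>\<kappa> r. 0 < \<kappa> \<and> 0 < r \<and> good p \<kappa> r"
    using C11_corkscrew_local[OF \<Omega>(1) b] unfolding good_def[symmetric] by metis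
  then obtain \<kappa> r where "\<And>p. p \<in> frontier \<Omega> \<Longrightarrow> 0 < \<kappa> p \<and> 0 < r p \<and> good p (\<kappa> p) (r p)"
    by metis
  then have kr: "\<And>p. p \<in> frontier \<Omega> \<Longrightarrow> 0 < \<kappa> p" "\<And>p. p \<in> frontier \<Omega> \<Longrightarrow> 0 < r p"
    "\<And>p q \<rho>. p \<in> frontier \<Omega> \<Longrightarrow> q \<in> frontier \<Omega> \<Longrightarrow> q \<in> ball p (r p) \<Longrightarrow> 0 < \<rho> \<Longrightarrow> \<rho> \<le> r p \<Longrightarrow>
      \<exists>a. ball a (\<kappa> p * \<rho>) \<subseteq> \<Omega> \<inter> ball q \<rho>"
    unfolding good_def by blast+
  have "compact (frontier \<Omega>)" using \<Omega>(2) by (rule compact_frontier_bounded)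
  then obtain F where F: "F \<subseteq> frontier \<Omega>" "finite F" "frontier \<Omega> \<subseteq> (\<Union>p\<in>F. ball p (r p))"
    by (rule compactE_image[of _ "frontier \<Omega>" "\<lambda>p. ball p (r p)"]) (use kr(2) in auto)
  show thesis
  proof
    \<comment> \<open>The inserted 1 keeps the minima meaningful when the frontier, and with it
      \<open>F\<close>, is empty.\<close>
    show "0 < Min (insert 1 (\<kappa> ` F))" "0 < Min (insert 1 (r ` F))"
      using F kr(1,2) by (auto simp: Min_gr_iff)
    fix q \<rho> assume q: "q \<in> frontier \<Omega>" and \<rho>: "0 < \<rho>" "\<rho> \<le> Min (insert 1 (r ` F))"
    obtain p where p: "p \<in> F" "q \<in> ball p (r p)" using F q by auto
    have "\<rho> \<le> r p" using \<rho> p F(2) by (auto simp: Min_le_iff)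
    then obtain a where a: "ball a (\<kappa> p * \<rho>) \<subseteq> \<Omega> \<inter> ball q \<rho>"
      using kr(3)[of p q \<rho>] p F(1) q \<rho>(1) by auto
    have "Min (insert 1 (\<kappa> ` F)) \<le> \<kappa> p" using F(2) p(1) by (intro Min_le) auto
    then have "ball a (Min (insert 1 (\<kappa> ` F)) * \<rho>) \<subseteq> ball a (\<kappa> p * \<rho>)"
      using \<rho> by (intro subset_ball mult_right_mono) auto
    then show "\<exists>a. ball a (Min (insert 1 (\<kappa> ` F)) * \<rho>) \<subseteq> \<Omega> \<inter> ball q \<rho>"
      using a by blast
  qed
qed

section \<open>The Robin kernel\<close>

lemma dpow_nonneg [simp]: "0 \<le> dpow s x y"
  by (simp add: dpow_def)

lemma dpow_pos: "x \<noteq> y \<Longrightarrow> 0 < dpow s x y"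
  by (simp add: dpow_def)

lemma dpow_commute: "dpow s x y = dpow s y x"
  by (simp add: dpow_def norm_minus_commute)

lemma inverse_dpow_eq: "1 / dpow s x (y::'a::euclidean_space) = norm (x - y) powr - (real DIM('a) + 2 * s)"
  unfolding dpow_def by (rule powr_minus_divide[symmetric])

lemma borel_measurable_dpow [measurable]:
  assumes [measurable]: "f \<in> M \<rightarrow>\<^sub>M borel" "g \<in> M \<rightarrow>\<^sub>M borel"
  shows "(\<lambda>x. dpow s (f x) (g x)) \<in> borel_measurable M"
  unfolding dpow_def by measurable

lemma borel_measurable_dpow_lebesgue [measurable]:
  "(\<lambda>y. dpow s x y) \<in> borel_measurable lebesgue" "(\<lambda>x. dpow s x y) \<in> borel_measurable lebesgue"
  by (rule measurable_completion, simp)+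

text \<open>Passing to Borel measure gives access to measurability of parameter integrals and to the
  affine change of variables; used for \<open>mass\<close> and for the reflection argument.\<close>

lemma set_lintegral_lborel:
  assumes [measurable]: "f \<in> borel_measurable borel" "A \<in> sets borel"
  shows "(LINT x:A|lebesgue. f x) = (LINT x:A|lborel. (f x :: real))"
  unfolding set_lebesgue_integral_def by (rule integral_completion) simp

lemma set_integrable_kernel_tail:
  fixes x :: "'a::euclidean_space"
  assumes "0 < s" "0 < r"
  shows "set_integrable lebesgue (- ball x r) (\<lambda>y. 1 / dpow s x y)"
  unfolding set_integrable_def
proof (rule integrableI_bounded)
  have [measurable]: "- ball x r \<in> sets lebesgue" by auto
  show "(\<lambda>y. indicator (- ball x r) y *\<^sub>R (1 / dpow s x y)) \<in> borel_measurable lebesgue"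
    by measurable
  have "(\<integral>\<^sup>+y. ennreal (norm (indicator (- ball x r) y *\<^sub>R (1 / dpow s x y))) \<partial>lebesgue)
      = (\<integral>\<^sup>+y. ennreal (norm (x - y) powr - (real DIM('a) + 2 * s)) * indicator (- ball x r) y \<partial>lborel)"
    unfolding nn_integral_completion inverse_dpow_eq
    by (intro nn_integral_cong) (auto split: split_indicator)
  also have "\<dots> < \<infinity>"
  proof -
    obtain K where "\<And>x::'a. (\<integral>\<^sup>+y. ennreal (norm (x - y) powr - (real DIM('a) + 2 * s)) * indicator (- ball x r) y \<partial>lborel) \<le> ennreal K"
      using nn_integral_kernel_tail[of "real DIM('a) + 2 * s" r, where 'a='a] assms by auto
    then show ?thesis by (rule order_le_less_trans) simp
  qed
  finally show "(\<integral>\<^sup>+y. ennreal (norm (indicator (- ball x r) y *\<^sub>R (1 / dpow s x y))) \<partial>lebesgue) < \<infinity>" .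
qed

lemma set_integrable_kernel_subset:
  fixes x :: "'a::euclidean_space"
  assumes "0 < s" "0 < r" "A \<in> sets lebesgue" "A \<inter> ball x r = {}"
  shows "set_integrable lebesgue A (\<lambda>y. 1 / dpow s x y)"
  using set_integrable_kernel_tail[of s r x] assms
  by (rule_tac set_integrable_subset[of _ "- ball x r"]) auto

section \<open>The mass of the kernel and its lower bounds outside \<Omega>\<close>

locale robin_kernel =
  fixes \<Omega> :: "'a::euclidean_space set" and \<beta> :: "'a \<Rightarrow> real" and s :: real
  assumes s_pos: "0 < s"
    and open_\<Omega>: "open \<Omega>" and bounded_\<Omega>: "bounded \<Omega>" and C11: "C11_boundary \<Omega>"
    and \<beta>_measurable [measurable]: "\<beta> \<in> borel_measurable lebesgue"
    and \<beta>_range: "\<And>x. 0 \<le> \<beta> x \<and> \<beta> x \<le> 1"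
begin

definition p :: real where "p = real DIM('a) + 2 * s"

definition mass :: "'a \<Rightarrow> real" where "mass z = (LINT w:\<Omega>|lebesgue. 1 / dpow s z w)"

lemma p_pos: "0 < p"
  using s_pos by (simp add: p_def add_nonneg_pos)

lemma dpow_eq: "dpow s x (y::'a) = norm (x - y) powr p"
  by (simp add: dpow_def p_def)

lemma \<Omega>_borel [measurable]: "\<Omega> \<in> sets borel"
  using open_\<Omega> by simp

lemma \<Omega>_lebesgue [measurable]: "\<Omega> \<in> sets lebesgue"
  using open_\<Omega> by simp

lemma compl_\<Omega>_lebesgue [measurable]: "- \<Omega> \<in> sets lebesgue"
  using open_\<Omega> by (simp add: borel_closed closed_Compl)

lemma mass_nonneg: "0 \<le> mass z"
  unfolding mass_def set_lebesgue_integral_def by (intro integral_nonneg_AE) auto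

lemma borel_measurable_mass [measurable]: "mass \<in> borel_measurable borel"
proof -
  have "mass = (\<lambda>z. LINT w:\<Omega>|lborel. 1 / dpow s z w)"
    unfolding mass_def[abs_def] by (intro ext set_lintegral_lborel) measurable
  also have "\<dots> \<in> borel_measurable borel"
    unfolding set_lebesgue_integral_def by measurable
  finally show ?thesis .
qed

lemma borel_measurable_mass_lebesgue [measurable]: "mass \<in> borel_measurable lebesgue"
  by (rule measurable_completion) simp

lemma set_integrable_mass:
  assumes "z \<notin> closure \<Omega>"
  shows "set_integrable lebesgue \<Omega> (\<lambda>w. 1 / dpow s z w)"
proof -
  obtain r where r: "0 < r" "ball z r \<subseteq> - closure \<Omega>"
    using assms by (metis ComplI closed_closure openE open_Compl)
  then show ?thesis
    using closure_subset[of \<Omega>] s_pos by (intro set_integrable_kernel_subset[of _ r]) auto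
qed

text \<open>On the ball the kernel is at least \<open>D powr - p\<close>. The lemma is applied to
  three balls: a small one in \<Omega> for mere positivity, a corkscrew ball when \<open>z\<close>
  is near \<Omega>, and a fixed ball around \<open>x\<close> when \<open>z\<close> is far.\<close>

lemma mass_lower_bound:
  assumes z: "z \<notin> closure \<Omega>" and b: "ball a \<rho> \<subseteq> \<Omega>" and \<rho>: "0 \<le> \<rho>"
    and D: "\<And>w. w \<in> ball a \<rho> \<Longrightarrow> norm (z - w) \<le> D"
  shows "unit_ball_vol (real DIM('a)) * \<rho> ^ DIM('a) * D powr - p \<le> mass z"
proof -
  have ib: "set_integrable lebesgue (ball a \<rho>) (\<lambda>w. D powr - p)"
    by (simp add: set_integrable_def lmeasurable_iff_integrable[symmetric] lmeasurable_ball)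
  have "unit_ball_vol (real DIM('a)) * \<rho> ^ DIM('a) * D powr - p = (LINT w:ball a \<rho>|lebesgue. D powr - p)"
  proof -
    have "measure lebesgue (ball a \<rho>) = unit_ball_vol (real DIM('a)) * \<rho> ^ DIM('a)"
      using content_ball[OF \<rho>, of a] by (simp add: measure_completion)
    moreover have "(LINT w:ball a \<rho>|lebesgue. D powr - p) = measure lebesgue (ball a \<rho>) * D powr - p"
      unfolding set_lebesgue_integral_def by simp
    ultimately show ?thesis by simp
  qed
  also have "\<dots> \<le> (LINT w:ball a \<rho>|lebesgue. 1 / dpow s z w)"
  proof (rule set_integral_mono[OF ib])
    show "set_integrable lebesgue (ball a \<rho>) (\<lambda>w. 1 / dpow s z w)"
      by (rule set_integrable_subset[OF set_integrable_mass[OF z] _ b]) simp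
    fix w assume w: "w \<in> ball a \<rho>"
    then have "z \<noteq> w" using b closure_subset z by blast
    then show "D powr - p \<le> 1 / dpow s z w"
      unfolding inverse_dpow_eq p_def[symmetric] using D[OF w] p_pos by (intro powr_mono2') auto
  qed
  also have "\<dots> \<le> mass z"
    unfolding mass_def set_lebesgue_integral_def
    using set_integrable_mass[OF z] b set_integrable_subset[OF set_integrable_mass[OF z] _ b]
    by (intro integral_mono) (auto simp: set_integrable_def split: split_indicator)
  finally show ?thesis .
qed

lemma mass_pos:
  assumes z: "z \<notin> closure \<Omega>" and ne: "\<Omega> \<noteq> {}"
  shows "0 < mass z"
proof -
  obtain x where "x \<in> \<Omega>" using ne by blast
  then obtain r where r: "0 < r" "ball x r \<subseteq> \<Omega>" using open_\<Omega> openE by blast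
  define D where "D = norm (z - x) + r"
  have "norm (z - w) \<le> D" if "w \<in> ball x r" for w
    using that norm_triangle_le[of "z - x" "x - w" D] by (simp add: D_def dist_norm)
  then have "unit_ball_vol (real DIM('a)) * r ^ DIM('a) * D powr - p \<le> mass z"
    using r by (intro mass_lower_bound[OF z r(2)]) auto
  moreover have "0 < D" using r by (simp add: D_def add_nonneg_pos)
  then have "0 < unit_ball_vol (real DIM('a)) * r ^ DIM('a) * D powr - p"
    using r by (intro mult_pos_pos) auto
  ultimately show ?thesis by simp
qed

text \<open>Allows almost everywhere arguments to treat exterior points as points off the closure,
  where \<open>mass\<close> is a convergent integral.\<close>

lemma AE_exterior: "AE z in lebesgue. z \<notin> \<Omega> \<longrightarrow> z \<notin> closure \<Omega>"
proof -
  have "frontier \<Omega> \<in> null_sets lebesgue"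
    using negligible_frontier_C11[OF open_\<Omega> C11] by (simp add: negligible_iff_null_sets)
  then have "AE z in lebesgue. z \<notin> frontier \<Omega>" by (rule AE_not_in)
  then show ?thesis
    by eventually_elim (use open_\<Omega> in \<open>auto simp: frontier_def interior_open\<close>)
qed

lemma norm_ge_of_ball:
  assumes "ball x r \<subseteq> \<Omega>" "z \<notin> \<Omega>" shows "r \<le> norm (x - z)"
  using assms by (auto simp: dist_norm not_less subset_iff)

text \<open>A segment from \<open>z\<close> to a point \<open>y\<close> of \<Omega> meets the
  frontier no farther from \<open>z\<close> than \<open>y\<close>. Hence a nearest frontier point,
  which exists because the frontier is closed, is at least as near as all of \<Omega>.\<close>

lemma frontier_closest_point:
  assumes z: "z \<notin> \<Omega>" and ne: "\<Omega> \<noteq> {}"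
  obtains q where "q \<in> frontier \<Omega>" "\<And>y. y \<in> \<Omega> \<Longrightarrow> dist z q \<le> dist z y"
proof -
  have seg: "\<exists>q\<in>frontier \<Omega>. dist z q \<le> dist z y" if y: "y \<in> \<Omega>" for y
  proof -
    have "closed_segment z y \<inter> frontier \<Omega> \<noteq> {}"
      using y z by (intro connected_Int_frontier) auto
    then obtain q where "q \<in> closed_segment z y" "q \<in> frontier \<Omega>" by blast
    then show ?thesis using segment_bound(1)[of q z y] by (auto simp: dist_norm norm_minus_commute)
  qed
  then have "frontier \<Omega> \<noteq> {}" using ne by blast
  then obtain q where q: "q \<in> frontier \<Omega>" "\<And>q'. q' \<in> frontier \<Omega> \<Longrightarrow> dist z q \<le> dist z q'"
    using distance_attains_inf[OF frontier_closed] by blast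
  show thesis
    by (rule that[OF q(1)]) (use seg q(2) order_trans in blast)
qed

text \<open>Near \<open>\<Omega>\<close> the corkscrew ball gives \<open>mass z \<ge> c d\<^sup>-\<^sup>2\<^sup>s\<close> with \<open>d\<close> the distance from \<open>z\<close> to the
  boundary, and \<open>d \<le> |y - z|\<close>; far away \<open>mass z\<close> is comparable to \<open>|x - z|\<^sup>-\<^sup>p\<close>.\<close>

lemma kernel_pointwise_bound:
  assumes x: "x \<in> \<Omega>"
  obtains C r R where "0 \<le> C" "0 < r" "0 < R"
    "\<And>y z. y \<in> \<Omega> \<Longrightarrow> z \<notin> closure \<Omega> \<Longrightarrow>
      1 / (dpow s x z * dpow s y z * mass z) \<le>
        C * (norm (y - z) powr - real DIM('a) * indicator {z. norm (y - z) \<le> R} z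
             + norm (y - z) powr - p * indicator (- ball y r) z)"
proof -
  define n where "n = DIM('a)"
  define V where "V = unit_ball_vol (real DIM('a))"
  have V: "0 < V" by (simp add: V_def)
  obtain \<kappa> r where \<kappa>: "0 < \<kappa>" and r: "0 < r" and ck: "\<And>q \<rho>. q \<in> frontier \<Omega> \<Longrightarrow> 0 < \<rho> \<Longrightarrow> \<rho> \<le> r \<Longrightarrow>
      \<exists>a. ball a (\<kappa> * \<rho>) \<subseteq> \<Omega> \<inter> ball q \<rho>"
    using C11_corkscrew[OF open_\<Omega> bounded_\<Omega> C11] by blast
  obtain \<delta> where \<delta>: "0 < \<delta>" "ball x \<delta> \<subseteq> \<Omega>" using x open_\<Omega> openE by blast
  obtain B where B: "0 < B" "\<And>y. y \<in> closure \<Omega> \<Longrightarrow> norm y \<le> B"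
    using bounded_closure[OF bounded_\<Omega>] unfolding bounded_pos by blast
  \<comment> \<open>If the distance \<open>d\<close> from \<open>z\<close> to its nearest frontier
    point \<open>q\<close> is at most \<open>r\<close>, then |y - z| \<le> |y - q| + d \<le>
    \<open>R\<close>. In \<open>C1\<close> the factor \<open>\<delta> powr - p\<close> bounds
    \<open>1 / dpow s x z\<close>, and the rest comes from the volume of the corkscrew ball.\<close>
  define R where "R = 2 * B + r"
  define C1 where "C1 = \<delta> powr - p * (2 powr p / (V * \<kappa> ^ n))"
  define C2 where "C2 = (1 + \<delta> / r) powr p / (V * \<delta> ^ n)"
  have C: "0 \<le> C1" "0 \<le> C2" using V \<kappa> \<delta> by (auto simp: C1_def C2_def)
  show thesis
  proof (rule that[of "C1 + C2" r R])
    fix y z assume y: "y \<in> \<Omega>" and z: "z \<notin> closure \<Omega>"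
    have z': "z \<notin> \<Omega>" using z closure_subset by blast
    have yz: "0 < norm (y - z)" using y z' by auto
    have ne: "\<Omega> \<noteq> {}" using x by blast
    have mz: "0 < mass z" using mass_pos[OF z ne] .
    have xz: "\<delta> \<le> norm (x - z)" using norm_ge_of_ball[OF \<delta>(2) z'] .
    obtain q where q: "q \<in> frontier \<Omega>" "\<And>y. y \<in> \<Omega> \<Longrightarrow> dist z q \<le> dist z y"
      using frontier_closest_point[OF z' ne] by blast
    define d where "d = dist z q"
    have "q \<in> closure \<Omega>" using q(1) by (simp add: frontier_def)
    then have d: "0 < d" using z by (auto simp: d_def)
    have dy: "d \<le> norm (y - z)" using q(2)[OF y] by (simp add: d_def dist_norm norm_minus_commute)
    \<comment> \<open>It remains to bound \<open>1 / (dpow s x z * mass z)\<close>: by a multiple of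
      |y - z|^(2s) in the near case, which turns the exponent -p into -n, and by a constant in the
      far case.\<close>
    have split: "1 / (dpow s x z * dpow s y z * mass z) = (1 / (dpow s x z * mass z)) * norm (y - z) powr - p"
      by (simp add: dpow_eq powr_minus_divide)
    show "1 / (dpow s x z * dpow s y z * mass z) \<le>
        (C1 + C2) * (norm (y - z) powr - real DIM('a) * indicator {z. norm (y - z) \<le> R} z
             + norm (y - z) powr - p * indicator (- ball y r) z)"
    proof (cases "d \<le> r")
      case True
      obtain a where a: "ball a (\<kappa> * d) \<subseteq> \<Omega> \<inter> ball q d" using ck[OF q(1) d True] by blast
      \<comment> \<open>Points of the corkscrew ball are within \<open>d\<close> of
        \<open>q\<close>, hence within \<open>2 * d\<close> of \<open>z\<close>. Volume d^n times
        kernel d^(-p) gives d^(-2s).\<close>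
      have "V * (\<kappa> * d) ^ n * (2 * d) powr - p \<le> mass z"
        unfolding V_def n_def
      proof (rule mass_lower_bound[OF z])
        fix w assume "w \<in> ball a (\<kappa> * d)"
        then have "dist q w < d" using a by auto
        then have "dist z w \<le> 2 * d" using dist_triangle[of z w q] by (simp add: d_def)
        then show "norm (z - w) \<le> 2 * d" by (simp add: dist_norm)
      qed (use a \<kappa> d in auto)
      moreover have "V * (\<kappa> * d) ^ n * (2 * d) powr - p = V * \<kappa> ^ n * 2 powr - p * d powr - (2 * s)"
      proof -
        have "d ^ n * d powr - p = d powr - (2 * s)"
          using d by (simp add: powr_realpow[symmetric] powr_add[symmetric] p_def n_def)
        then show ?thesis using d by (simp add: powr_mult power_mult_distrib mult_ac)
      qed
      ultimately have m: "V * \<kappa> ^ n * 2 powr - p * d powr - (2 * s) \<le> mass z" by simp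
      have "\<delta> powr p \<le> dpow s x z"
        unfolding dpow_eq using xz \<delta> p_pos by (intro powr_mono2) auto
      then have "\<delta> powr p * (V * \<kappa> ^ n * 2 powr - p * d powr - (2 * s)) \<le> dpow s x z * mass z"
        using m V \<kappa> by (intro mult_mono) auto
      moreover have "0 < \<delta> powr p * (V * \<kappa> ^ n * 2 powr - p * d powr - (2 * s))"
        using \<delta> V \<kappa> d by auto
      ultimately have "1 / (dpow s x z * mass z) \<le> 1 / (\<delta> powr p * (V * \<kappa> ^ n * 2 powr - p * d powr - (2 * s)))"
        by (intro divide_left_mono) (auto intro: mult_pos_pos)
      also have "\<dots> = C1 * d powr (2 * s)"
        by (simp add: C1_def powr_minus divide_inverse)
      also have "\<dots> \<le> C1 * norm (y - z) powr (2 * s)"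
        using C d dy s_pos by (intro mult_left_mono powr_mono2) auto
      finally have "1 / (dpow s x z * dpow s y z * mass z) \<le> C1 * norm (y - z) powr (2 * s) * norm (y - z) powr - p"
        unfolding split by (intro mult_right_mono) auto
      also have "\<dots> = C1 * norm (y - z) powr - real DIM('a)"
        by (simp add: mult.assoc powr_add[symmetric] p_def)
      finally have le: "1 / (dpow s x z * dpow s y z * mass z) \<le> C1 * norm (y - z) powr - real DIM('a)" .
      have "dist y z \<le> dist y q + dist q z" by (rule dist_triangle)
      also have "dist y q \<le> norm y + norm q" by (simp add: dist_norm norm_triangle_ineq4)
      also have "\<dots> \<le> B + B" using B(2)[of y] B(2)[of q] y closure_subset \<open>q \<in> closure \<Omega>\<close> by (intro add_mono) auto
      finally have "norm (y - z) \<le> R" using True by (simp add: R_def d_def dist_norm norm_minus_commute)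
      then have "C1 * norm (y - z) powr - real DIM('a)
          \<le> (C1 + C2) * (norm (y - z) powr - real DIM('a) * indicator {z. norm (y - z) \<le> R} z
             + norm (y - z) powr - p * indicator (- ball y r) z)"
        using C by (intro mult_mono) auto
      with le show ?thesis by linarith
    next
      case False
      have xz': "r \<le> norm (x - z)"
        using q(2)[OF x] False by (simp add: d_def dist_norm norm_minus_commute)
      \<comment> \<open>Since |x - z| \<ge> \<open>r\<close>, the radius \<delta> is at most
        \<open>\<delta> / r\<close> times |x - z|; thus \<open>ball x \<delta>\<close> lies within
        \<open>A * norm (x - z)\<close> of \<open>z\<close>.\<close>
      define A where "A = 1 + \<delta> / r"
      have A: "0 < A" using \<delta> r by (simp add: A_def add_pos_pos)
      define D where "D = A * norm (x - z)"
      have "V * \<delta> ^ n * D powr - p \<le> mass z"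
        unfolding V_def n_def
      proof (rule mass_lower_bound[OF z \<delta>(2)])
        fix w assume w: "w \<in> ball x \<delta>"
        have "norm (z - w) \<le> norm (x - z) + \<delta>"
          using w norm_triangle_ineq[of "z - x" "x - w"] by (simp add: dist_norm norm_minus_commute)
        also have "\<delta> = \<delta> / r * r" using r by simp
        also have "\<dots> \<le> \<delta> / r * norm (x - z)" using xz' \<delta> r by (intro mult_left_mono) auto
        finally show "norm (z - w) \<le> D" by (simp add: D_def A_def algebra_simps)
      qed (use \<delta> in auto)
      then have "dpow s x z * (V * \<delta> ^ n * D powr - p) \<le> dpow s x z * mass z"
        by (intro mult_left_mono) auto
      moreover have eq: "dpow s x z * (V * \<delta> ^ n * D powr - p) = 1 / C2"
      proof -
        have "D powr - p = A powr - p * norm (x - z) powr - p"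
          using A by (simp add: D_def powr_mult)
        moreover have "norm (x - z) powr p * norm (x - z) powr - p = 1"
        proof -
          have "norm (x - z) powr p \<noteq> 0" using xz \<delta>(1) by auto
          then show ?thesis by (simp add: powr_minus)
        qed
        ultimately have "dpow s x z * (V * \<delta> ^ n * D powr - p) = V * \<delta> ^ n * A powr - p"
          by (simp add: dpow_eq)
        also have "\<dots> = 1 / C2"
        proof -
          have "C2 = A powr p / (V * \<delta> ^ n)" by (simp add: C2_def A_def)
          then show ?thesis by (simp add: powr_minus_divide)
        qed
        finally show ?thesis .
      qed
      moreover have "0 < C2" using V \<delta> A by (simp add: C2_def A_def[symmetric])
      ultimately have "1 / (dpow s x z * mass z) \<le> 1 / (1 / C2)"
        by (intro frac_le) auto
      then have "1 / (dpow s x z * mass z) \<le> C2" by simp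
      then have "1 / (dpow s x z * dpow s y z * mass z) \<le> C2 * norm (y - z) powr - p"
        unfolding split by (intro mult_right_mono) auto
      moreover have "z \<in> - ball y r" using False dy by (simp add: dist_norm)
      then have "C2 * norm (y - z) powr - p
          \<le> (C1 + C2) * (norm (y - z) powr - real DIM('a) * indicator {z. norm (y - z) \<le> R} z
             + norm (y - z) powr - p * indicator (- ball y r) z)"
        using C by (intro mult_mono) auto
      ultimately show ?thesis by linarith
    qed
  qed (use C r B in \<open>auto simp: R_def\<close>)
qed

section \<open>Integrability, symmetry and logarithmic bound of \<open>k_beta\<close>\<close>

lemma k_beta_integrand_eq:
  "k_beta_integrand s \<Omega> \<beta> x y z = (1 - \<beta> z) / mass z * (1 / dpow s x z) * (1 / dpow s y z)"
  by (simp add: k_beta_integrand_def mass_def)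

lemma k_beta_integrand_nonneg: "0 \<le> k_beta_integrand s \<Omega> \<beta> x y z"
  unfolding k_beta_integrand_eq using \<beta>_range[of z] mass_nonneg[of z] by simp

lemma borel_measurable_k_beta_integrand [measurable]:
  "(\<lambda>z. k_beta_integrand s \<Omega> \<beta> x y z) \<in> borel_measurable lebesgue"
  unfolding k_beta_integrand_eq by measurable

text \<open>The separation \<delta> is left free because it is chosen in two ways: as the radius of
  a ball around \<open>y\<close> in \<Omega>, which yields integrability, and as the distance to the
  support of 1 - \<beta>, which yields the logarithmic bound. \<open>K\<close> depends on
  \<open>x\<close> but on neither \<open>y\<close> nor \<delta>.\<close>

lemma nn_integral_k_beta_le:
  assumes x: "x \<in> \<Omega>"
  obtains K where "0 \<le> K" "\<And>y \<delta>. y \<in> \<Omega> \<Longrightarrow> 0 < \<delta> \<Longrightarrow> (\<And>z. z \<notin> \<Omega> \<Longrightarrow> \<beta> z \<noteq> 1 \<Longrightarrow> \<delta> \<le> norm (y - z)) \<Longrightarrow>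
    (\<integral>\<^sup>+z. ennreal (k_beta_integrand s \<Omega> \<beta> x y z) * indicator (- \<Omega>) z \<partial>lebesgue) \<le> ennreal (K * (1 + \<bar>ln \<delta>\<bar>))"
proof -
  obtain C r R where C: "0 \<le> C" and r: "0 < r" and R: "0 < R"
    and bound: "\<And>y z. y \<in> \<Omega> \<Longrightarrow> z \<notin> closure \<Omega> \<Longrightarrow>
      1 / (dpow s x z * dpow s y z * mass z) \<le>
        C * (norm (y - z) powr - real DIM('a) * indicator {z. norm (y - z) \<le> R} z
             + norm (y - z) powr - p * indicator (- ball y r) z)"
    using kernel_pointwise_bound[OF x] by blast
  obtain K1 where K1: "0 \<le> K1" "\<And>y \<delta>. 0 < \<delta> \<Longrightarrow>
    (\<integral>\<^sup>+z. ennreal (norm (y - z) powr - real DIM('a)) * indicator {z. \<delta> \<le> norm (y - z) \<and> norm (y - z) \<le> R} (z::'a) \<partial>lborel)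
      \<le> ennreal (K1 * (1 + \<bar>ln \<delta>\<bar>))"
    using nn_integral_kernel_log[OF R, where 'a='a] by blast
  have "real DIM('a) < p" using s_pos by (simp add: p_def)
  then obtain K2 where K2: "0 \<le> K2" "\<And>y::'a.
    (\<integral>\<^sup>+z. ennreal (norm (y - z) powr - p) * indicator (- ball y r) z \<partial>lborel) \<le> ennreal K2"
    using nn_integral_kernel_tail[of p r, where 'a='a] r by blast
  show thesis
  proof
    show "0 \<le> C * (K1 + K2)" using C K1 K2 by simp
    fix y \<delta> assume y: "y \<in> \<Omega>" and \<delta>: "0 < \<delta>" and sep: "\<And>z. z \<notin> \<Omega> \<Longrightarrow> \<beta> z \<noteq> 1 \<Longrightarrow> \<delta> \<le> norm (y - z)"
    let ?a = "\<lambda>z. ennreal (norm (y - z) powr - real DIM('a)) * indicator {z. \<delta> \<le> norm (y - z) \<and> norm (y - z) \<le> R} z"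
    let ?b = "\<lambda>z. ennreal (norm (y - z) powr - p) * indicator (- ball y r) z"
    have "closed {z. \<delta> \<le> norm (y - z) \<and> norm (y - z) \<le> R}"
      by (intro closed_Collect_conj closed_Collect_le continuous_intros)
    then have [measurable]: "{z. \<delta> \<le> norm (y - z) \<and> norm (y - z) \<le> R} \<in> sets borel"
      by (rule borel_closed)
    have "(\<integral>\<^sup>+z. ennreal (k_beta_integrand s \<Omega> \<beta> x y z) * indicator (- \<Omega>) z \<partial>lebesgue)
        \<le> (\<integral>\<^sup>+z. ennreal C * (?a z + ?b z) \<partial>lebesgue)"
    proof (rule nn_integral_mono_AE, use AE_exterior in eventually_elim)
      fix z assume z: "z \<notin> \<Omega> \<longrightarrow> z \<notin> closure \<Omega>"
      show "ennreal (k_beta_integrand s \<Omega> \<beta> x y z) * indicator (- \<Omega>) z \<le> ennreal C * (?a z + ?b z)"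
      proof (cases "z \<in> \<Omega> \<or> \<beta> z = 1")
        case True
        then show ?thesis by (auto simp: k_beta_integrand_def)
      next
        case False
        then have sepz: "\<delta> \<le> norm (y - z)" using sep by blast
        have "k_beta_integrand s \<Omega> \<beta> x y z \<le> 1 / (dpow s x z * dpow s y z * mass z)"
          unfolding k_beta_integrand_def mass_def[symmetric] using \<beta>_range[of z] mass_nonneg[of z]
          by (intro divide_right_mono) auto
        also have "\<dots> \<le> C * (norm (y - z) powr - real DIM('a) * indicator {z. norm (y - z) \<le> R} z
             + norm (y - z) powr - p * indicator (- ball y r) z)"
          using bound[OF y] z False by blast
        finally have "ennreal (k_beta_integrand s \<Omega> \<beta> x y z) \<le>
            ennreal (C * (norm (y - z) powr - real DIM('a) * indicator {z. norm (y - z) \<le> R} z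
             + norm (y - z) powr - p * indicator (- ball y r) z))" by (rule ennreal_leI)
        also have "\<dots> = ennreal C * (?a z + ?b z)"
          using C sepz by (simp add: ennreal_mult'' ennreal_plus indicator_def)
        finally show ?thesis using False by simp
      qed
    qed
    also have "\<dots> = ennreal C * ((\<integral>\<^sup>+z. ?a z \<partial>lborel) + (\<integral>\<^sup>+z. ?b z \<partial>lborel))"
      unfolding nn_integral_completion
      by (simp add: nn_integral_cmult nn_integral_add)
    also have "\<dots> \<le> ennreal C * (ennreal (K1 * (1 + \<bar>ln \<delta>\<bar>)) + ennreal K2)"
      by (intro mult_left_mono add_mono K1 K2 \<delta>) simp
    also have "\<dots> = ennreal (C * (K1 * (1 + \<bar>ln \<delta>\<bar>) + K2))"
      using C K1 K2 by (simp add: ennreal_mult'' ennreal_plus)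
    also have "\<dots> \<le> ennreal (C * (K1 + K2) * (1 + \<bar>ln \<delta>\<bar>))"
    proof (rule ennreal_leI)
      \<comment> \<open>The contribution of the tail has no logarithm and is absorbed by the summand
        1.\<close>
      have "K2 \<le> K2 * (1 + \<bar>ln \<delta>\<bar>)" using K2(1) by (simp add: algebra_simps)
      then have "C * (K1 * (1 + \<bar>ln \<delta>\<bar>) + K2) \<le> C * (K1 * (1 + \<bar>ln \<delta>\<bar>) + K2 * (1 + \<bar>ln \<delta>\<bar>))"
        using C by (intro mult_left_mono) auto
      then show "C * (K1 * (1 + \<bar>ln \<delta>\<bar>) + K2) \<le> C * (K1 + K2) * (1 + \<bar>ln \<delta>\<bar>)"
        by (simp add: algebra_simps)
    qed
    finally show "(\<integral>\<^sup>+z. ennreal (k_beta_integrand s \<Omega> \<beta> x y z) * indicator (- \<Omega>) z \<partial>lebesgue)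
      \<le> ennreal (C * (K1 + K2) * (1 + \<bar>ln \<delta>\<bar>))" .
  qed
qed

lemma set_integrable_k_beta_integrand:
  assumes x: "x \<in> \<Omega>" and y: "y \<in> \<Omega>"
  shows "set_integrable lebesgue (- \<Omega>) (k_beta_integrand s \<Omega> \<beta> x y)"
proof -
  obtain \<delta> where \<delta>: "0 < \<delta>" "ball y \<delta> \<subseteq> \<Omega>" using y open_\<Omega> openE by blast
  obtain K where "(\<integral>\<^sup>+z. ennreal (k_beta_integrand s \<Omega> \<beta> x y z) * indicator (- \<Omega>) z \<partial>lebesgue) \<le> ennreal (K * (1 + \<bar>ln \<delta>\<bar>))"
    using nn_integral_k_beta_le[OF x] y \<delta>(1) norm_ge_of_ball[OF \<delta>(2)] by metis
  also have "(\<integral>\<^sup>+z. ennreal (k_beta_integrand s \<Omega> \<beta> x y z) * indicator (- \<Omega>) z \<partial>lebesgue)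
      = (\<integral>\<^sup>+z. ennreal (norm (indicator (- \<Omega>) z *\<^sub>R k_beta_integrand s \<Omega> \<beta> x y z)) \<partial>lebesgue)"
    by (intro nn_integral_cong) (auto split: split_indicator simp: k_beta_integrand_nonneg)
  finally show ?thesis
    unfolding set_integrable_def
    by (intro integrableI_bounded) (measurable, auto intro: order_le_less_trans)
qed

lemma k_beta_nonneg: "0 \<le> k_beta s \<Omega> \<beta> x y"
  unfolding k_beta_def set_lebesgue_integral_def
  by (intro integral_nonneg_AE) (simp add: k_beta_integrand_nonneg)

lemma ennreal_k_beta:
  assumes "x \<in> \<Omega>" "y \<in> \<Omega>"
  shows "ennreal (k_beta s \<Omega> \<beta> x y) =
    (\<integral>\<^sup>+z. ennreal (k_beta_integrand s \<Omega> \<beta> x y z) * indicator (- \<Omega>) z \<partial>lebesgue)"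
proof -
  have "ennreal (k_beta s \<Omega> \<beta> x y) = (\<integral>\<^sup>+z. ennreal (indicator (- \<Omega>) z *\<^sub>R k_beta_integrand s \<Omega> \<beta> x y z) \<partial>lebesgue)"
    unfolding k_beta_def set_lebesgue_integral_def
    using set_integrable_k_beta_integrand[OF assms] unfolding set_integrable_def
    by (intro nn_integral_eq_integral[symmetric]) (auto simp: k_beta_integrand_nonneg)
  also have "\<dots> = (\<integral>\<^sup>+z. ennreal (k_beta_integrand s \<Omega> \<beta> x y z) * indicator (- \<Omega>) z \<partial>lebesgue)"
    by (intro nn_integral_cong) (auto split: split_indicator)
  finally show ?thesis .
qed

lemma k_beta_commute: "k_beta s \<Omega> \<beta> x y = k_beta s \<Omega> \<beta> y x"
  by (simp add: k_beta_def k_beta_integrand_def mult_ac)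

lemma k_beta_log_bound:
  assumes x: "x \<in> \<Omega>"
  obtains K where "0 < K" "\<And>y \<delta>. y \<in> \<Omega> \<Longrightarrow> 0 < \<delta> \<Longrightarrow> (\<And>z. z \<notin> \<Omega> \<Longrightarrow> \<beta> z \<noteq> 1 \<Longrightarrow> \<delta> \<le> norm (y - z)) \<Longrightarrow>
    k_beta s \<Omega> \<beta> x y \<le> K * (1 + \<bar>ln \<delta>\<bar>)"
proof -
  obtain K where K: "0 \<le> K" "\<And>y \<delta>. y \<in> \<Omega> \<Longrightarrow> 0 < \<delta> \<Longrightarrow> (\<And>z. z \<notin> \<Omega> \<Longrightarrow> \<beta> z \<noteq> 1 \<Longrightarrow> \<delta> \<le> norm (y - z)) \<Longrightarrow>
    (\<integral>\<^sup>+z. ennreal (k_beta_integrand s \<Omega> \<beta> x y z) * indicator (- \<Omega>) z \<partial>lebesgue) \<le> ennreal (K * (1 + \<bar>ln \<delta>\<bar>))"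
    using nn_integral_k_beta_le[OF x] by blast
  show thesis
  proof
    \<comment> \<open>\<open>K\<close> may be 0, while a strictly positive constant is
      wanted.\<close>
    show "0 < K + 1" using K by simp
    fix y \<delta> assume y: "y \<in> \<Omega>" and h: "0 < \<delta>" "\<And>z. z \<notin> \<Omega> \<Longrightarrow> \<beta> z \<noteq> 1 \<Longrightarrow> \<delta> \<le> norm (y - z)"
    have "ennreal (k_beta s \<Omega> \<beta> x y) \<le> ennreal (K * (1 + \<bar>ln \<delta>\<bar>))"
      unfolding ennreal_k_beta[OF x y] using K(2)[OF y h] .
    then have "k_beta s \<Omega> \<beta> x y \<le> K * (1 + \<bar>ln \<delta>\<bar>)" using K(1) by (simp add: ennreal_le_iff)
    also have "\<dots> \<le> (K + 1) * (1 + \<bar>ln \<delta>\<bar>)" by (intro mult_right_mono) auto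
    finally show "k_beta s \<Omega> \<beta> x y \<le> (K + 1) * (1 + \<bar>ln \<delta>\<bar>)" .
  qed
qed

lemma k_beta_ext_log_bound:
  assumes x: "x \<in> \<Omega>"
  shows "\<exists>C>0. \<forall>y\<in>\<Omega>. ereal (k_beta s \<Omega> \<beta> x y) \<le>
    ereal C * (1 + \<bar>ext_ln (ext_dist y (robin_support \<Omega> \<beta>))\<bar>)"
proof -
  let ?N = "robin_support \<Omega> \<beta>"
  obtain K where K: "0 < K" "\<And>y \<delta>. y \<in> \<Omega> \<Longrightarrow> 0 < \<delta> \<Longrightarrow> (\<And>z. z \<notin> \<Omega> \<Longrightarrow> \<beta> z \<noteq> 1 \<Longrightarrow> \<delta> \<le> norm (y - z)) \<Longrightarrow>
    k_beta s \<Omega> \<beta> x y \<le> K * (1 + \<bar>ln \<delta>\<bar>)"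
    using k_beta_log_bound[OF x] by blast
  have "ereal (k_beta s \<Omega> \<beta> x y) \<le> ereal K * (1 + \<bar>ext_ln (ext_dist y ?N)\<bar>)" if y: "y \<in> \<Omega>" for y
  proof (cases "?N = {}")
    case True
    \<comment> \<open>For empty support the right-hand side is infinite because
      \<open>K > 0\<close>.\<close>
    then have "ext_dist y ?N = \<infinity>" by (simp add: ext_dist_def top_ereal_def)
    then show ?thesis using K(1) by (simp add: ext_ln_def)
  next
    case False
    \<comment> \<open>The complement of \<Omega> is closed, so taking the closure does not enter
      \<Omega>. Hence \<open>y\<close> has positive distance from \<open>?N\<close>, and the
      extended logarithm is an ordinary one.\<close>
    have "?N \<subseteq> - \<Omega>"
      unfolding robin_support_def using open_\<Omega> by (intro closure_minimal) auto
    then have "y \<notin> ?N" using y by blast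
    moreover have "closed ?N" by (simp add: robin_support_def)
    ultimately have pos: "0 < infdist y ?N"
      using False infdist_pos_not_in_closed by blast
    have "ext_dist y ?N = ereal (infdist y ?N)"
      unfolding ext_dist_def infdist_notempty[OF False]
      using False by (intro ereal_Inf'[symmetric, of "dist y ` ?N", unfolded image_image]) auto
    then have "ext_ln (ext_dist y ?N) = ereal (ln (infdist y ?N))"
      using pos by (simp add: ext_ln_def)
    moreover have "k_beta s \<Omega> \<beta> x y \<le> K * (1 + \<bar>ln (infdist y ?N)\<bar>)"
    proof (rule K(2)[OF y pos])
      fix z assume "z \<notin> \<Omega>" "\<beta> z \<noteq> 1"
      then have "z \<in> ?N" unfolding robin_support_def by (intro closure_subset[THEN subsetD]) simp
      then show "infdist y ?N \<le> norm (y - z)" using infdist_le[of z ?N y] by (simp add: dist_norm)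
    qed
    ultimately show ?thesis by (simp add: one_ereal_def)
  qed
  then show ?thesis using K(1) by blast
qed

section \<open>Continuity of \<open>k_beta\<close>\<close>

lemma dpow_ge_half:
  fixes x x0 z :: 'a
  assumes "norm (x - x0) \<le> norm (x0 - z) / 2"
  shows "2 powr - p * dpow s x0 z \<le> dpow s x z"
proof -
  have "norm (x0 - z) \<le> norm (x - x0) + norm (x - z)"
    using norm_triangle_ineq[of "x0 - x" "x - z"] by (simp add: norm_minus_commute)
  then have "norm (x0 - z) / 2 \<le> norm (x - z)" using assms by linarith
  then have "(norm (x0 - z) / 2) powr p \<le> norm (x - z) powr p"
    using p_pos by (intro powr_mono2) auto
  then show ?thesis by (simp add: dpow_eq powr_divide powr_minus_divide)
qed

lemma inverse_dpow_le:
  fixes x x0 z :: 'a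
  assumes "norm (x - x0) \<le> norm (x0 - z) / 2" "x0 \<noteq> z"
  shows "1 / dpow s x z \<le> 2 powr p * (1 / dpow s x0 z)"
proof -
  have pos: "0 < 2 powr - p * dpow s x0 z" using dpow_pos[OF assms(2)] by simp
  have "1 / dpow s x z \<le> 1 / (2 powr - p * dpow s x0 z)"
    using dpow_ge_half[OF assms(1)] pos by (intro divide_left_mono) (auto intro!: mult_pos_pos)
  then show ?thesis by (simp add: powr_minus_divide)
qed

lemma tendsto_inverse_dpow:
  fixes X :: "nat \<Rightarrow> 'a"
  assumes "X \<longlonglongrightarrow> x" "x \<noteq> z"
  shows "(\<lambda>n. 1 / dpow s (X n) z) \<longlonglongrightarrow> 1 / dpow s x z"
proof -
  have "(\<lambda>n. norm (X n - z) powr p) \<longlonglongrightarrow> norm (x - z) powr p"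
    using assms by (intro tendsto_intros) auto
  then show ?thesis
    unfolding dpow_eq using assms(2) by (intro tendsto_divide tendsto_const) auto
qed

text \<open>Dominated convergence along sequences. The majorant is the integrand at the limit point
  itself, since moving a point by at most half its distance to \<open>z\<close> enlarges each of the
  two kernels by at most \<open>2 powr p\<close>.\<close>

lemma continuous_on_k_beta: "continuous_on (\<Omega> \<times> \<Omega>) (\<lambda>(x, y). k_beta s \<Omega> \<beta> x y)"
  unfolding continuous_on_sequentially
proof (intro ballI allI impI)
  fix P and a assume a: "a \<in> \<Omega> \<times> \<Omega>" and P: "(\<forall>n. P n \<in> \<Omega> \<times> \<Omega>) \<and> P \<longlonglongrightarrow> a"
  obtain x0 y0 where a0: "a = (x0, y0)" "x0 \<in> \<Omega>" "y0 \<in> \<Omega>" using a by blast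
  define X where "X n = fst (P n)" for n
  define Y where "Y n = snd (P n)" for n
  have X: "X \<longlonglongrightarrow> x0" and Y: "Y \<longlonglongrightarrow> y0"
    unfolding X_def Y_def using P tendsto_fst[of P a] tendsto_snd[of P a] a0(1) by auto
  obtain d1 where d1: "0 < d1" "ball x0 d1 \<subseteq> \<Omega>" using a0 open_\<Omega> openE by blast
  obtain d2 where d2: "0 < d2" "ball y0 d2 \<subseteq> \<Omega>" using a0 open_\<Omega> openE by blast
  \<comment> \<open>For \<open>z\<close> outside \<Omega> we have |x0 - z| \<ge> \<open>d1\<close>
    and |y0 - z| \<ge> \<open>d2\<close>, so half of these radii is what
    \<open>inverse_dpow_le\<close> asks for, uniformly in \<open>z\<close>.\<close>
  have "\<forall>\<^sub>F n in sequentially. dist (X n) x0 < d1 / 2 \<and> dist (Y n) y0 < d2 / 2"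
    using tendstoD[OF X, of "d1 / 2"] tendstoD[OF Y, of "d2 / 2"] d1 d2 by (auto intro: eventually_conj)
  then obtain N where N: "\<And>n. N \<le> n \<Longrightarrow> dist (X n) x0 < d1 / 2 \<and> dist (Y n) y0 < d2 / 2"
    unfolding eventually_sequentially by blast
  let ?f = "\<lambda>x y z. indicator (- \<Omega>) z *\<^sub>R k_beta_integrand s \<Omega> \<beta> x y z"
  have "(\<lambda>n. integral\<^sup>L lebesgue (?f (X (n + N)) (Y (n + N)))) \<longlonglongrightarrow> integral\<^sup>L lebesgue (?f x0 y0)"
  proof (rule integral_dominated_convergence)
    show "integrable lebesgue (\<lambda>z. (2 powr p * 2 powr p) * ?f x0 y0 z)"
      using set_integrable_k_beta_integrand[OF a0(2,3)] unfolding set_integrable_def by (rule integrable_mult_right)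
    show "AE z in lebesgue. (\<lambda>n. ?f (X (n + N)) (Y (n + N)) z) \<longlonglongrightarrow> ?f x0 y0 z"
    proof (rule AE_I2)
      fix z
      show "(\<lambda>n. ?f (X (n + N)) (Y (n + N)) z) \<longlonglongrightarrow> ?f x0 y0 z"
      proof (cases "z \<in> \<Omega>")
        case False
        then have "x0 \<noteq> z" "y0 \<noteq> z" using a0 by auto
        then show ?thesis
          unfolding k_beta_integrand_eq
          by (intro tendsto_scaleR tendsto_mult tendsto_const tendsto_inverse_dpow
              LIMSEQ_ignore_initial_segment X Y)
      qed simp
    qed
    show "AE z in lebesgue. norm (?f (X (n + N)) (Y (n + N)) z) \<le> (2 powr p * 2 powr p) * ?f x0 y0 z" for n
    proof (rule AE_I2)
      fix z
      show "norm (?f (X (n + N)) (Y (n + N)) z) \<le> (2 powr p * 2 powr p) * ?f x0 y0 z"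
      proof (cases "z \<in> \<Omega>")
        case False
        have n: "norm (X (n + N) - x0) \<le> norm (x0 - z) / 2" "norm (Y (n + N) - y0) \<le> norm (y0 - z) / 2"
          using N[of "n + N"] norm_ge_of_ball[OF d1(2) False] norm_ge_of_ball[OF d2(2) False]
          by (auto simp: dist_norm)
        have ne: "x0 \<noteq> z" "y0 \<noteq> z" using a0 False by auto
        have i: "1 / dpow s (X (n + N)) z \<le> 2 powr p * (1 / dpow s x0 z)"
          "1 / dpow s (Y (n + N)) z \<le> 2 powr p * (1 / dpow s y0 z)"
          by (rule inverse_dpow_le[OF n(1) ne(1)], rule inverse_dpow_le[OF n(2) ne(2)])
        have "k_beta_integrand s \<Omega> \<beta> (X (n + N)) (Y (n + N)) z
          \<le> (1 - \<beta> z) / mass z * (2 powr p * (1 / dpow s x0 z)) * (2 powr p * (1 / dpow s y0 z))"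
          unfolding k_beta_integrand_eq using \<beta>_range[of z] mass_nonneg[of z]
          by (intro mult_mono i order_refl) auto
        also have "\<dots> = (2 powr p * 2 powr p) * k_beta_integrand s \<Omega> \<beta> x0 y0 z"
          unfolding k_beta_integrand_eq by simp
        finally show ?thesis using False k_beta_integrand_nonneg by simp
      qed simp
    qed
  qed measurable
  then have "(\<lambda>n. k_beta s \<Omega> \<beta> (X (n + N)) (Y (n + N))) \<longlonglongrightarrow> k_beta s \<Omega> \<beta> x0 y0"
    unfolding k_beta_def set_lebesgue_integral_def .
  then have "(\<lambda>n. k_beta s \<Omega> \<beta> (X n) (Y n)) \<longlonglongrightarrow> k_beta s \<Omega> \<beta> x0 y0"
    by (rule LIMSEQ_offset)
  then show "((\<lambda>(x, y). k_beta s \<Omega> \<beta> x y) \<circ> P) \<longlonglongrightarrow> (\<lambda>(x, y). k_beta s \<Omega> \<beta> x y) a"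
    by (simp add: a0(1) X_def Y_def comp_def case_prod_unfold)
qed

end

section \<open>Principal values\<close>

text \<open>A relational form that carries existence and value together, so that values can be added
  piece by piece before \<open>Lim\<close> is ever evaluated.\<close>

definition has_pv :: "'a::euclidean_space set \<Rightarrow> 'a \<Rightarrow> ('a \<Rightarrow> real) \<Rightarrow> real \<Rightarrow> bool" where
  "has_pv D x F L \<longleftrightarrow>
     (\<forall>\<epsilon>>0. set_integrable lebesgue (D - ball x \<epsilon>) F) \<and>
     ((\<lambda>\<epsilon>. LINT y:(D - ball x \<epsilon>)|lebesgue. F y) \<longlongrightarrow> L) (at_right 0)"

lemma pv_exists_iff_has_pv: "pv_exists D x F \<longleftrightarrow> (\<exists>L. has_pv D x F L)"
  by (simp add: pv_exists_def has_pv_def)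

lemma pv_integral_eq: "has_pv D x F L \<Longrightarrow> pv_integral D x F = L"
  by (simp add: pv_integral_def has_pv_def tendsto_Lim)

lemma eventually_at_right_0: "eventually (\<lambda>\<epsilon>::real. 0 < \<epsilon>) (at_right 0)"
  by (rule eventually_at_right_less)

lemma has_pv_add:
  assumes "has_pv D x F A" "has_pv D x G B"
  shows "has_pv D x (\<lambda>y. F y + G y) (A + B)"
  unfolding has_pv_def
proof
  show "\<forall>\<epsilon>>0. set_integrable lebesgue (D - ball x \<epsilon>) (\<lambda>y. F y + G y)"
    using assms by (auto simp: has_pv_def)
  have "((\<lambda>\<epsilon>. (LINT y:(D - ball x \<epsilon>)|lebesgue. F y) + (LINT y:(D - ball x \<epsilon>)|lebesgue. G y)) \<longlongrightarrow> A + B) (at_right 0)"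
    using assms by (auto simp: has_pv_def intro: tendsto_add)
  then show "((\<lambda>\<epsilon>. LINT y:(D - ball x \<epsilon>)|lebesgue. F y + G y) \<longlongrightarrow> A + B) (at_right 0)"
    by (rule Lim_transform_eventually)
      (rule eventually_mono[OF eventually_at_right_0], use assms in \<open>simp add: has_pv_def\<close>)
qed

lemma has_pv_Un:
  assumes "has_pv D x F A" "has_pv E x F B" "D \<inter> E = {}" "D \<in> sets lebesgue" "E \<in> sets lebesgue"
  shows "has_pv (D \<union> E) x F (A + B)"
  unfolding has_pv_def Un_Diff
proof
  have [simp]: "D - ball x \<epsilon> \<in> sets lebesgue" "E - ball x \<epsilon> \<in> sets lebesgue" for \<epsilon>
    using assms(4,5) by auto
  show "\<forall>\<epsilon>>0. set_integrable lebesgue (D - ball x \<epsilon> \<union> (E - ball x \<epsilon>)) F"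
    using assms(1,2) by (auto simp: has_pv_def intro!: set_integrable_Un)
  have "((\<lambda>\<epsilon>. (LINT y:(D - ball x \<epsilon>)|lebesgue. F y) + (LINT y:(E - ball x \<epsilon>)|lebesgue. F y)) \<longlongrightarrow> A + B) (at_right 0)"
    using assms by (auto simp: has_pv_def intro: tendsto_add)
  then show "((\<lambda>\<epsilon>. LINT y:(D - ball x \<epsilon> \<union> (E - ball x \<epsilon>))|lebesgue. F y) \<longlongrightarrow> A + B) (at_right 0)"
    by (rule Lim_transform_eventually)
      (rule eventually_mono[OF eventually_at_right_0], subst set_integral_Un,
       use assms in \<open>auto simp: has_pv_def\<close>)
qed

lemma has_pv_cong:
  assumes "has_pv D x F A" "\<And>y. y \<in> D \<Longrightarrow> F y = G y"
  shows "has_pv D x G A"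
proof -
  have "(\<lambda>y. indicator (D - ball x \<epsilon>) y *\<^sub>R F y) = (\<lambda>y. indicator (D - ball x \<epsilon>) y *\<^sub>R G y)" for \<epsilon>
    using assms(2) by (auto split: split_indicator)
  then show ?thesis
    using assms(1) by (simp add: has_pv_def set_integrable_def set_lebesgue_integral_def)
qed

lemma has_pv_set_integrable:
  fixes x :: "'a::euclidean_space"
  assumes D: "D \<in> sets lebesgue" and F: "set_integrable lebesgue D F"
  shows "has_pv D x F (LINT y:D|lebesgue. F y)"
  unfolding has_pv_def
proof
  have sub: "set_integrable lebesgue (D - ball x \<epsilon>) F" for \<epsilon>
    by (rule set_integrable_subset[OF F]) (use D in auto)
  then show "\<forall>\<epsilon>>0. set_integrable lebesgue (D - ball x \<epsilon>) F" by blast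
  \<comment> \<open>With t = 1/\<epsilon> the limit at 0 becomes one at infinity, with majorant |F|.
    The truncated integrands are eventually equal to the full one at every point except
    \<open>x\<close>, a null set.\<close>
  have "((\<lambda>t. LINT y|lebesgue. indicator (D - ball x (inverse t)) y *\<^sub>R F y) \<longlongrightarrow>
      (LINT y|lebesgue. indicator D y *\<^sub>R F y)) at_top"
  proof (rule integral_dominated_convergence_at_top)
    show "(\<lambda>y. indicator D y *\<^sub>R F y) \<in> borel_measurable lebesgue"
      using F unfolding set_integrable_def by (rule borel_measurable_integrable)
    show "(\<lambda>y. indicator (D - ball x (inverse t)) y *\<^sub>R F y) \<in> borel_measurable lebesgue" for t
      using sub unfolding set_integrable_def by (rule borel_measurable_integrable)
    show "integrable lebesgue (\<lambda>y. norm (indicator D y *\<^sub>R F y))"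
      using F unfolding set_integrable_def by (rule integrable_norm)
    have "negligible {x}" by simp
    then have "AE y in lebesgue. y \<notin> {x}"
      unfolding negligible_iff_null_sets by (rule AE_not_in)
    then show "AE y in lebesgue. ((\<lambda>t. indicator (D - ball x (inverse t)) y *\<^sub>R F y) \<longlongrightarrow> indicator D y *\<^sub>R F y) at_top"
    proof eventually_elim
      case (elim y)
      then have "0 < dist x y" by simp
      then have "\<forall>\<^sub>F t in at_top. inverse t < dist x y"
        using order_tendstoD(2)[OF tendsto_inverse_0_at_top[OF filterlim_ident]] by blast
      then have "\<forall>\<^sub>F t in at_top. indicator D y *\<^sub>R F y = indicator (D - ball x (inverse t)) y *\<^sub>R F y"
        by eventually_elim (auto split: split_indicator)
      then show ?case by (rule Lim_transform_eventually[OF tendsto_const])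
    qed
  qed (auto intro!: AE_I2 always_eventually split: split_indicator)
  then show "((\<lambda>\<epsilon>. LINT y:(D - ball x \<epsilon>)|lebesgue. F y) \<longlongrightarrow> (LINT y:D|lebesgue. F y)) (at_right 0)"
    unfolding filterlim_at_right_to_top set_lebesgue_integral_def .
qed

text \<open>The point reflection at \<open>x\<close> preserves Lebesgue measure, so the integral
  equals its own negative.\<close>

lemma set_integral_reflect_eq_0:
  fixes x :: "'a::euclidean_space" and f :: "'a \<Rightarrow> real"
  assumes [measurable]: "f \<in> borel_measurable borel" "A \<in> sets borel"
    and A: "\<And>y. 2 *\<^sub>R x - y \<in> A \<longleftrightarrow> y \<in> A" and f: "\<And>y. f (2 *\<^sub>R x - y) = - f y"
  shows "(LINT y:A|lebesgue. f y) = 0"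
proof -
  let ?h = "\<lambda>y. indicator A y *\<^sub>R f y"
  have T[measurable]: "(\<lambda>y. 2 *\<^sub>R x + (-1) *\<^sub>R y) \<in> borel \<rightarrow>\<^sub>M borel" by measurable
  have "lborel = density (distr lborel borel (\<lambda>y. 2 *\<^sub>R x + (-1) *\<^sub>R y)) (\<lambda>_. \<bar>-1::real\<bar>^DIM('a))"
    by (rule lborel_affine) simp
  then have "lborel = distr lborel borel (\<lambda>y. 2 *\<^sub>R x + (-1) *\<^sub>R y)"
    by (simp add: density_1)
  then have "integral\<^sup>L lborel ?h = integral\<^sup>L (distr lborel borel (\<lambda>y. 2 *\<^sub>R x + (-1) *\<^sub>R y)) ?h" by simp
  also have "\<dots> = (LINT y|lborel. ?h (2 *\<^sub>R x + (-1) *\<^sub>R y))"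
    by (rule integral_distr) measurable
  also have "\<dots> = (LINT y|lborel. - ?h y)"
    by (rule Bochner_Integration.integral_cong) (simp_all add: A f indicator_def)
  also have "\<dots> = - integral\<^sup>L lborel ?h" by simp
  finally have "integral\<^sup>L lborel ?h = 0" by simp
  then show ?thesis using set_lintegral_lborel[OF assms(1,2)] by (simp add: set_lebesgue_integral_def)
qed

lemma has_pv_linear_kernel:
  fixes x a :: "'a::euclidean_space"
  assumes s: "0 < s" and r: "0 < r"
  shows "has_pv (ball x r) x (\<lambda>y. ((x - y) \<bullet> a) / dpow s x y) 0"
  unfolding has_pv_def
proof
  have meas: "(\<lambda>y. ((x - y) \<bullet> a) / dpow s x y) \<in> borel_measurable borel" by measurable
  show "\<forall>\<epsilon>>0. set_integrable lebesgue (ball x r - ball x \<epsilon>) (\<lambda>y. ((x - y) \<bullet> a) / dpow s x y)"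
  proof (intro allI impI)
    fix \<epsilon> :: real assume \<epsilon>: "0 < \<epsilon>"
    have "set_integrable lebesgue (ball x r - ball x \<epsilon>) (\<lambda>y. (r * norm a) * (1 / dpow s x y))"
      by (rule set_integrable_mult_right) (rule set_integrable_kernel_subset[OF s \<epsilon>], auto)
    then show "set_integrable lebesgue (ball x r - ball x \<epsilon>) (\<lambda>y. ((x - y) \<bullet> a) / dpow s x y)"
    proof (rule set_integrable_bound)
      show "set_borel_measurable lebesgue (ball x r - ball x \<epsilon>) (\<lambda>y. ((x - y) \<bullet> a) / dpow s x y)"
      proof -
        have [measurable]: "ball x r - ball x \<epsilon> \<in> sets borel" by simp
        have "(\<lambda>y. indicator (ball x r - ball x \<epsilon>) y *\<^sub>R (((x - y) \<bullet> a) / dpow s x y)) \<in> borel_measurable borel"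
          using meas by measurable
        then show ?thesis
          unfolding set_borel_measurable_def by (intro measurable_completion) simp
      qed
      show "AE y in lebesgue. y \<in> ball x r - ball x \<epsilon> \<longrightarrow>
          norm (((x - y) \<bullet> a) / dpow s x y) \<le> norm ((r * norm a) * (1 / dpow s x y))"
      proof (intro AE_I2 impI)
        fix y assume y: "y \<in> ball x r - ball x \<epsilon>"
        have "\<bar>(x - y) \<bullet> a\<bar> \<le> norm (x - y) * norm a" by (rule Cauchy_Schwarz_ineq2)
        also have "\<dots> \<le> r * norm a" using y by (intro mult_right_mono) (auto simp: dist_norm)
        finally show "norm (((x - y) \<bullet> a) / dpow s x y) \<le> norm ((r * norm a) * (1 / dpow s x y))"
          using r by (simp add: abs_mult divide_right_mono)
      qed
    qed
  qed
  have "(LINT y:(ball x r - ball x \<epsilon>)|lebesgue. ((x - y) \<bullet> a) / dpow s x y) = 0" for \<epsilon>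
  proof (rule set_integral_reflect_eq_0[OF meas, where x = x])
    have d: "x - (2 *\<^sub>R x - y) = - (x - y)" for y :: 'a by (simp add: scaleR_2)
    show "2 *\<^sub>R x - y \<in> ball x r - ball x \<epsilon> \<longleftrightarrow> y \<in> ball x r - ball x \<epsilon>" for y
      by (simp only: Diff_iff mem_ball dist_norm d norm_minus_cancel)
    show "((x - (2 *\<^sub>R x - y)) \<bullet> a) / dpow s x (2 *\<^sub>R x - y) = - (((x - y) \<bullet> a) / dpow s x y)" for y
      by (simp only: dpow_def d norm_minus_cancel inner_minus_left minus_divide_left)
  qed simp
  then show "((\<lambda>\<epsilon>. LINT y:(ball x r - ball x \<epsilon>)|lebesgue. ((x - y) \<bullet> a) / dpow s x y) \<longlongrightarrow> 0) (at_right 0)"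
    by simp
qed

lemma set_integrable_kernel_near:
  fixes x :: "'a::euclidean_space"
  assumes "0 < q" "q < real DIM('a)" "0 < r"
  shows "set_integrable lebesgue (ball x r) (\<lambda>y. norm (x - y) powr - q)"
  unfolding set_integrable_def
proof (rule integrableI_bounded)
  have [measurable]: "ball x r \<in> sets borel" by simp
  have "(\<lambda>y. indicator (ball x r) y *\<^sub>R norm (x - y) powr - q) \<in> borel_measurable borel"
    by measurable
  then show "(\<lambda>y. indicator (ball x r) y *\<^sub>R norm (x - y) powr - q) \<in> borel_measurable lebesgue"
    by (intro measurable_completion) simp
  have "(\<integral>\<^sup>+y. ennreal (norm (indicator (ball x r) y *\<^sub>R norm (x - y) powr - q)) \<partial>lebesgue)
      = (\<integral>\<^sup>+y. ennreal (norm (x - y) powr - q) * indicator (ball x r) y \<partial>lborel)"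
    unfolding nn_integral_completion by (intro nn_integral_cong) (auto split: split_indicator)
  then show "(\<integral>\<^sup>+y. ennreal (norm (indicator (ball x r) y *\<^sub>R norm (x - y) powr - q)) \<partial>lebesgue) < \<infinity>"
    using nn_integral_kernel_near[OF assms] by simp
qed

section \<open>Product of Lebesgue measures and almost everywhere changes\<close>

lemma sigma_finite_lebesgue: "sigma_finite_measure (lebesgue :: 'a::euclidean_space measure)"
proof
  show "\<exists>A::'a set set. countable A \<and> A \<subseteq> sets lebesgue \<and> \<Union> A = space lebesgue \<and> (\<forall>a\<in>A. emeasure lebesgue a \<noteq> \<infinity>)"
  proof (intro exI conjI ballI)
    show "countable (range (\<lambda>n::nat. ball (0::'a) (real n)))" by simp
    show "range (\<lambda>n::nat. ball (0::'a) (real n)) \<subseteq> sets lebesgue" by auto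
    have "x \<in> \<Union> (range (\<lambda>n::nat. ball (0::'a) (real n)))" for x :: 'a
      using reals_Archimedean2[of "norm x"] by (auto simp: dist_norm)
    then show "\<Union> (range (\<lambda>n::nat. ball (0::'a) (real n))) = space lebesgue" by auto
    fix a assume "a \<in> range (\<lambda>n::nat. ball (0::'a) (real n))"
    then show "emeasure lebesgue a \<noteq> \<infinity>" by (auto simp: emeasure_ball)
  qed
qed

text \<open>Fubini is run on the product of the completed measures because \<open>u\<close> and
  \<beta> are only Lebesgue measurable.\<close>

interpretation lebesgue_pair: pair_sigma_finite
  "lebesgue :: 'a::euclidean_space measure" "lebesgue :: 'a measure"
  by (intro pair_sigma_finite.intro sigma_finite_lebesgue)

lemma borel_measurable_dpow_pair [measurable]:
  "(\<lambda>q. dpow s (fst q) (snd q :: 'a::euclidean_space)) \<in> borel_measurable (lebesgue \<Otimes>\<^sub>M lebesgue)"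
proof -
  have id: "(\<lambda>x. x) \<in> lebesgue \<rightarrow>\<^sub>M (borel :: 'a measure)" by (rule measurable_completion) simp
  show ?thesis
    by (intro borel_measurable_dpow measurable_compose[OF measurable_fst id] measurable_compose[OF measurable_snd id])
qed

text \<open>Measurability of \<open>g\<close> is a conclusion here, by completeness of the measure.
  This is how \<open>u\<close> outside \<Omega>, known only through an almost everywhere identity,
  becomes integrable against the kernel.\<close>

lemma set_integrable_AE_cong:
  fixes f g :: "'a::euclidean_space \<Rightarrow> real"
  assumes f: "set_integrable lebesgue S f" and ae: "AE x in lebesgue. x \<in> S \<longrightarrow> f x = g x"
  shows "set_integrable lebesgue S g" "(LINT x:S|lebesgue. g x) = (LINT x:S|lebesgue. f x)"
proof -
  obtain N where N: "N \<in> null_sets lebesgue" "{x. \<not> (x \<in> S \<longrightarrow> f x = g x)} \<subseteq> N"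
    using ae unfolding eventually_ae_filter by auto
  show g: "set_integrable lebesgue S g"
    by (rule absolutely_integrable_spike[OF f]) (use N in \<open>auto simp: negligible_iff_null_sets\<close>)
  show "(LINT x:S|lebesgue. g x) = (LINT x:S|lebesgue. f x)"
    unfolding set_lebesgue_integral_def
  proof (rule integral_cong_AE)
    show "AE x in lebesgue. indicator S x *\<^sub>R g x = indicator S x *\<^sub>R f x"
      using ae by eventually_elim (auto split: split_indicator)
  qed (use f g in \<open>auto simp: set_integrable_def\<close>)
qed

section \<open>The Robin problem\<close>

locale robin_problem = robin_kernel \<Omega> \<beta> s for \<Omega> :: "'a::euclidean_space set" and \<beta> s +
  fixes u :: "'a \<Rightarrow> real" and \<alpha> :: real
  assumes s_less_1: "s < 1" and \<beta>_zero: "\<And>x. x \<in> \<Omega> \<Longrightarrow> \<beta> x = 0"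
    and \<alpha>_pos: "0 < \<alpha>" and u_holder: "holder_loc (2 * s + \<alpha>) \<Omega> u" and u_Linfty: "Linfty_on \<Omega> u"
    and robin: "AE x in lebesgue. x \<notin> \<Omega> \<longrightarrow> \<beta> x * u x + (1 - \<beta> x) * nonlocal_normal s \<Omega> u x = 0"
begin

section \<open>The Robin condition solved outside \<Omega>\<close>

text \<open>The extension by zero is measurable and essentially bounded on the whole space, whereas
  these facts are given for \<open>u\<close> only on \<Omega>.\<close>

definition u1 :: "'a \<Rightarrow> real" where "u1 x = indicator \<Omega> x * u x"

definition u_bound :: real where
  "u_bound = (SOME M. 0 \<le> M \<and> (AE x in lebesgue. \<bar>u1 x\<bar> \<le> M))"

lemma u1_eq: "x \<in> \<Omega> \<Longrightarrow> u1 x = u x"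
  by (simp add: u1_def)

lemma u1_measurable [measurable]: "u1 \<in> borel_measurable lebesgue"
  using u_Linfty unfolding Linfty_on_def set_borel_measurable_def u1_def[abs_def] by simp

lemma u_bound: "0 \<le> u_bound" "AE x in lebesgue. \<bar>u1 x\<bar> \<le> u_bound"
proof -
  obtain M where "AE x in lebesgue. x \<in> \<Omega> \<longrightarrow> \<bar>u x\<bar> \<le> M"
    using u_Linfty unfolding Linfty_on_def by blast
  then have "AE x in lebesgue. \<bar>u1 x\<bar> \<le> \<bar>M\<bar>"
    by eventually_elim (auto simp: u1_def split: split_indicator)
  then have "\<exists>M. 0 \<le> M \<and> (AE x in lebesgue. \<bar>u1 x\<bar> \<le> M)" by (intro exI[of _ "\<bar>M\<bar>"]) simp
  from someI_ex[OF this] show "0 \<le> u_bound" "AE x in lebesgue. \<bar>u1 x\<bar> \<le> u_bound" unfolding u_bound_def by auto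
qed

definition avg :: "'a \<Rightarrow> real" where "avg z = (LINT y:\<Omega>|lebesgue. u y / dpow s z y) / mass z"

lemma avg_eq: "avg z = (LINT y|lebesgue. u1 y / dpow s z y) / mass z"
  unfolding avg_def set_lebesgue_integral_def u1_def by (simp add: mult.commute)

lemma avg_measurable [measurable]: "avg \<in> borel_measurable lebesgue"
proof -
  have m: "(\<lambda>q::'a \<times> 'a. u1 (snd q) / dpow s (fst q) (snd q)) \<in> borel_measurable (lebesgue \<Otimes>\<^sub>M lebesgue)"
    by measurable
  have "(\<lambda>z. LINT y|lebesgue. u1 y / dpow s z y) \<in> borel_measurable lebesgue"
    by (rule sigma_finite_measure.borel_measurable_lebesgue_integral[OF sigma_finite_lebesgue])
      (use m in \<open>simp add: case_prod_unfold\<close>)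
  then show ?thesis unfolding avg_eq[abs_def] by measurable
qed

lemma set_integrable_bounded_mult:
  fixes f g :: "'a \<Rightarrow> real"
  assumes f: "set_integrable lebesgue S f" and [measurable]: "S \<in> sets lebesgue" "f \<in> borel_measurable lebesgue" "g \<in> borel_measurable lebesgue"
    and b: "AE x in lebesgue. x \<in> S \<longrightarrow> \<bar>g x\<bar> \<le> B"
  shows "set_integrable lebesgue S (\<lambda>x. g x * f x)"
proof (rule set_integrable_bound[OF set_integrable_mult_right[of "\<bar>B\<bar>"]])
  show "set_integrable lebesgue S f" by (rule f)
  show "set_borel_measurable lebesgue S (\<lambda>x. g x * f x)"
    unfolding set_borel_measurable_def by measurable
  show "AE x in lebesgue. x \<in> S \<longrightarrow> norm (g x * f x) \<le> norm (\<bar>B\<bar> * f x)"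
    using b by eventually_elim (auto simp: abs_mult intro!: mult_right_mono)
qed

lemma set_integrable_u_kernel:
  assumes "z \<notin> closure \<Omega>"
  shows "set_integrable lebesgue \<Omega> (\<lambda>y. u y / dpow s z y)"
proof -
  have "set_integrable lebesgue \<Omega> (\<lambda>y. u1 y * (1 / dpow s z y))"
    by (rule set_integrable_bounded_mult[OF set_integrable_mass[OF assms], where B = u_bound])
      (measurable, use u_bound(2) in auto)
  then show ?thesis
    by (subst set_integrable_cong[OF refl refl, where f' = "\<lambda>y. u1 y * (1 / dpow s z y)"])
      (simp_all add: u1_eq)
qed

lemma set_integral_diff_kernel:
  assumes z: "z \<notin> closure \<Omega>" and ne: "\<Omega> \<noteq> {}"
  shows "set_integrable lebesgue \<Omega> (\<lambda>y. (t - u y) / dpow s z y)"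
    "(LINT y:\<Omega>|lebesgue. (t - u y) / dpow s z y) = mass z * (t - avg z)"
proof -
  have i: "set_integrable lebesgue \<Omega> (\<lambda>y. t * (1 / dpow s z y))"
    by (intro set_integrable_mult_right set_integrable_mass[OF z])
  have eq: "(\<lambda>y. (t - u y) / dpow s z y) = (\<lambda>y. t * (1 / dpow s z y) - u y / dpow s z y)"
    by (simp add: diff_divide_distrib)
  show "set_integrable lebesgue \<Omega> (\<lambda>y. (t - u y) / dpow s z y)"
    unfolding eq by (intro set_integral_diff(1) i set_integrable_u_kernel z)
  have "(LINT y:\<Omega>|lebesgue. (t - u y) / dpow s z y) = t * mass z - (LINT y:\<Omega>|lebesgue. u y / dpow s z y)"
    unfolding eq set_integral_diff(2)[OF i set_integrable_u_kernel[OF z]] set_integral_mult_right mass_def ..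
  also have "(LINT y:\<Omega>|lebesgue. u y / dpow s z y) = mass z * avg z"
    using mass_pos[OF z ne] by (simp add: avg_def)
  finally show "(LINT y:\<Omega>|lebesgue. (t - u y) / dpow s z y) = mass z * (t - avg z)"
    by (simp add: algebra_simps)
qed

text \<open>The normal derivative is \<open>u z - avg z\<close>, so the coefficient of
  \<open>u z\<close> in the Robin condition is \<beta> + (1 - \<beta>) = 1. The condition can
  therefore be solved for \<open>u z\<close> whatever the value of \<beta>, the Dirichlet and
  Neumann cases included.\<close>

lemma u_exterior:
  assumes ne: "\<Omega> \<noteq> {}"
  shows "AE z in lebesgue. z \<notin> \<Omega> \<longrightarrow> u z = (1 - \<beta> z) * avg z"
  using robin AE_exterior
proof eventually_elim
  case (elim z)
  show ?case
  proof
    assume z: "z \<notin> \<Omega>"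
    then have z': "z \<notin> closure \<Omega>" using elim by blast
    have "nonlocal_normal s \<Omega> u z = u z - avg z"
      unfolding nonlocal_normal_def diff_quot_def set_integral_diff_kernel(2)[OF z' ne] mass_def[symmetric]
      using mass_pos[OF z' ne] by simp
    then have "\<beta> z * u z + (1 - \<beta> z) * (u z - avg z) = 0" using elim z by simp
    then show "u z = (1 - \<beta> z) * avg z" by (simp add: algebra_simps)
  qed
qed

text \<open>Integrated over \<open>z\<close> this gives \<open>(u x - u y) k\<^sub>\<beta>(x, y)\<close>, and over \<open>y\<close> it gives
  \<open>(1 - \<beta> z) (u x - avg z) / |x - z|\<^sup>p\<close>.\<close>

definition double_integrand :: "'a \<Rightarrow> 'a \<Rightarrow> 'a \<Rightarrow> real" where
  "double_integrand x z y = indicator (- \<Omega>) z * indicator \<Omega> y * (u x - u1 y) * k_beta_integrand s \<Omega> \<beta> x y z"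

section \<open>Exchanging the integrals over \<open>y\<close> and \<open>z\<close>\<close>

lemma set_integrable_exterior_kernel:
  assumes "x \<in> \<Omega>"
  shows "set_integrable lebesgue (- \<Omega>) (\<lambda>z. 1 / dpow s x z)"
proof -
  obtain r where "0 < r" "ball x r \<subseteq> \<Omega>" using assms open_\<Omega> openE by blast
  then show ?thesis using s_pos by (intro set_integrable_kernel_subset[of s r]) auto
qed

lemma integrable_double_integrand:
  assumes x: "x \<in> \<Omega>"
  shows "integrable (lebesgue \<Otimes>\<^sub>M lebesgue) (\<lambda>(z, y). double_integrand x z y)"
proof (rule integrableI_bounded)
  define B where "B = \<bar>u x\<bar> + u_bound"
  have B: "0 \<le> B" using u_bound by (simp add: B_def)
  have [measurable]: "(\<lambda>q::'a \<times> 'a. dpow s (snd q) (fst q)) \<in> borel_measurable (lebesgue \<Otimes>\<^sub>M lebesgue)"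
    using borel_measurable_dpow_pair by (simp add: dpow_commute)
  have meas[measurable]: "(\<lambda>(z, y). double_integrand x z y) \<in> borel_measurable (lebesgue \<Otimes>\<^sub>M lebesgue)"
    unfolding double_integrand_def k_beta_integrand_eq case_prod_unfold by measurable
  show "(\<lambda>(z, y). double_integrand x z y) \<in> borel_measurable (lebesgue \<Otimes>\<^sub>M lebesgue)" by (rule meas)
  \<comment> \<open>By Tonelli, absolute values may be integrated in \<open>y\<close> first. What
    remains is at most \<open>B\<close> times the kernel at \<open>x\<close>, which is integrable
    outside \<Omega> since \<open>x\<close> has positive distance from the complement.\<close>
  have inner: "(\<integral>\<^sup>+y. ennreal (norm (double_integrand x z y)) \<partial>lebesgue) \<le> ennreal (B * (indicator (- \<Omega>) z * (1 / dpow s x z)))"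
    if z: "z \<notin> \<Omega> \<longrightarrow> z \<notin> closure \<Omega>" for z
  proof (cases "z \<in> \<Omega>")
    case True
    then show ?thesis by (simp add: double_integrand_def)
  next
    case False
    then have z': "z \<notin> closure \<Omega>" using z by blast
    define c where "c = B * ((1 - \<beta> z) / mass z * (1 / dpow s x z))"
    have c: "0 \<le> c" using B \<beta>_range[of z] mass_nonneg[of z] by (simp add: c_def)
    have "(\<integral>\<^sup>+y. ennreal (norm (double_integrand x z y)) \<partial>lebesgue)
        \<le> (\<integral>\<^sup>+y. ennreal c * ennreal (indicator \<Omega> y *\<^sub>R (1 / dpow s z y)) \<partial>lebesgue)"
    proof (rule nn_integral_mono_AE, use u_bound(2) in eventually_elim)
      case (elim y)
      show ?case
      proof (cases "y \<in> \<Omega>")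
        case True
        have "norm (double_integrand x z y) = \<bar>u x - u1 y\<bar> * k_beta_integrand s \<Omega> \<beta> x y z"
          using True False k_beta_integrand_nonneg[of x y z] by (simp add: double_integrand_def abs_mult)
        also have "\<dots> \<le> B * k_beta_integrand s \<Omega> \<beta> x y z"
          using elim k_beta_integrand_nonneg[of x y z] by (intro mult_right_mono) (auto simp: B_def)
        also have "\<dots> = c * (1 / dpow s z y)"
          by (simp add: k_beta_integrand_eq c_def dpow_commute[of s y])
        finally show ?thesis using True c by (simp add: ennreal_mult''[symmetric] ennreal_leI)
      qed (simp add: double_integrand_def)
    qed
    also have "\<dots> = ennreal c * (\<integral>\<^sup>+y. ennreal (indicator \<Omega> y *\<^sub>R (1 / dpow s z y)) \<partial>lebesgue)"
      by (rule nn_integral_cmult) measurable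
    also have "(\<integral>\<^sup>+y. ennreal (indicator \<Omega> y *\<^sub>R (1 / dpow s z y)) \<partial>lebesgue) = ennreal (mass z)"
      unfolding mass_def set_lebesgue_integral_def
      using set_integrable_mass[OF z'] unfolding set_integrable_def
      by (intro nn_integral_eq_integral) auto
    also have "ennreal c * ennreal (mass z) = ennreal (c * mass z)"
      by (rule ennreal_mult''[symmetric, OF mass_nonneg])
    also have "c * mass z = B * (1 - \<beta> z) * (1 / dpow s x z)"
    proof -
      have "mass z \<noteq> 0" using mass_pos[OF z'] x by (metis empty_iff less_irrefl)
      then show ?thesis by (simp add: c_def)
    qed
    also have "ennreal \<dots> \<le> ennreal (B * (indicator (- \<Omega>) z * (1 / dpow s x z)))"
      using False B \<beta>_range[of z] by (intro ennreal_leI) (simp add: divide_right_mono mult_left_le)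
    finally show ?thesis .
  qed
  have "(\<integral>\<^sup>+q. ennreal (norm (case q of (z, y) \<Rightarrow> double_integrand x z y)) \<partial>(lebesgue \<Otimes>\<^sub>M lebesgue))
      = (\<integral>\<^sup>+z. \<integral>\<^sup>+y. ennreal (norm (double_integrand x z y)) \<partial>lebesgue \<partial>lebesgue)"
    by (subst sigma_finite_measure.nn_integral_fst[OF sigma_finite_lebesgue, symmetric]) simp_all
  also have "\<dots> \<le> (\<integral>\<^sup>+z. ennreal (B * (indicator (- \<Omega>) z * (1 / dpow s x z))) \<partial>lebesgue)"
    by (rule nn_integral_mono_AE, use AE_exterior in eventually_elim) (rule inner)
  also have "\<dots> = ennreal (LINT z|lebesgue. B * (indicator (- \<Omega>) z * (1 / dpow s x z)))"
    using set_integrable_exterior_kernel[OF x] B unfolding set_integrable_def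
    by (intro nn_integral_eq_integral integrable_mult_right) auto
  also have "\<dots> < \<infinity>" by simp
  finally show "(\<integral>\<^sup>+q. ennreal (norm (case q of (z, y) \<Rightarrow> double_integrand x z y)) \<partial>(lebesgue \<Otimes>\<^sub>M lebesgue)) < \<infinity>" .
qed

lemma integral_double_integrand_z:
  assumes "x \<in> \<Omega>"
  shows "(LINT z|lebesgue. double_integrand x z y) = indicator \<Omega> y *\<^sub>R ((u x - u y) * k_beta s \<Omega> \<beta> x y)"
proof -
  have "(LINT z|lebesgue. double_integrand x z y)
      = (LINT z|lebesgue. (indicator \<Omega> y * (u x - u1 y)) * (indicator (- \<Omega>) z *\<^sub>R k_beta_integrand s \<Omega> \<beta> x y z))"
    by (simp add: double_integrand_def mult_ac)
  also have "\<dots> = (indicator \<Omega> y * (u x - u1 y)) * k_beta s \<Omega> \<beta> x y"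
    unfolding k_beta_def set_lebesgue_integral_def by (rule integral_mult_right_zero)
  also have "\<dots> = indicator \<Omega> y *\<^sub>R ((u x - u y) * k_beta s \<Omega> \<beta> x y)"
    by (simp add: u1_def split: split_indicator)
  finally show ?thesis .
qed

lemma integral_double_integrand_y:
  assumes x: "x \<in> \<Omega>" and z: "z \<notin> \<Omega> \<longrightarrow> z \<notin> closure \<Omega>"
  shows "(LINT y|lebesgue. double_integrand x z y) = indicator (- \<Omega>) z *\<^sub>R ((1 - \<beta> z) * (u x - avg z) / dpow s x z)"
proof (cases "z \<in> \<Omega>")
  case False
  then have z': "z \<notin> closure \<Omega>" using z by blast
  have ne: "\<Omega> \<noteq> {}" using x by blast
  have "(LINT y|lebesgue. double_integrand x z y)
      = (LINT y|lebesgue. ((1 - \<beta> z) / mass z * (1 / dpow s x z)) * (indicator \<Omega> y *\<^sub>R ((u x - u y) / dpow s z y)))"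
    using False by (intro Bochner_Integration.integral_cong)
      (auto simp: double_integrand_def k_beta_integrand_eq u1_def dpow_commute[of s z] split: split_indicator)
  also have "\<dots> = ((1 - \<beta> z) / mass z * (1 / dpow s x z)) * (mass z * (u x - avg z))"
    unfolding set_integral_diff_kernel(2)[OF z' ne, symmetric] set_lebesgue_integral_def
    by (rule integral_mult_right_zero)
  finally show ?thesis using False mass_pos[OF z' ne] by simp
qed (simp add: double_integrand_def)

text \<open>The integral in \<open>z\<close> is identified for every \<open>y\<close>, the integral
  in \<open>y\<close> only for \<open>z\<close> off the frontier; hence the almost everywhere
  congruence on the second side alone.\<close>

lemma fubini:
  assumes x: "x \<in> \<Omega>"
  shows "set_integrable lebesgue \<Omega> (\<lambda>y. (u x - u y) * k_beta s \<Omega> \<beta> x y)"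
    and "set_integrable lebesgue (- \<Omega>) (\<lambda>z. (1 - \<beta> z) * (u x - avg z) / dpow s x z)"
    and "(LINT y:\<Omega>|lebesgue. (u x - u y) * k_beta s \<Omega> \<beta> x y)
      = (LINT z:(- \<Omega>)|lebesgue. (1 - \<beta> z) * (u x - avg z) / dpow s x z)"
proof -
  note int = integrable_double_integrand[OF x]
  show "set_integrable lebesgue \<Omega> (\<lambda>y. (u x - u y) * k_beta s \<Omega> \<beta> x y)"
    unfolding set_integrable_def integral_double_integrand_z[OF x, symmetric]
    by (rule lebesgue_pair.integrable_snd[OF int])
  have ae: "AE z in lebesgue. (LINT y|lebesgue. double_integrand x z y) =
      indicator (- \<Omega>) z *\<^sub>R ((1 - \<beta> z) * (u x - avg z) / dpow s x z)"
    using AE_exterior by eventually_elim (rule integral_double_integrand_y[OF x])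
  have i: "integrable lebesgue (\<lambda>z. LINT y|lebesgue. double_integrand x z y)"
    by (rule lebesgue_pair.integrable_fst[OF int])
  have m: "(\<lambda>z. indicator (- \<Omega>) z *\<^sub>R ((1 - \<beta> z) * (u x - avg z) / dpow s x z)) \<in> borel_measurable lebesgue"
    by measurable
  show "set_integrable lebesgue (- \<Omega>) (\<lambda>z. (1 - \<beta> z) * (u x - avg z) / dpow s x z)"
    unfolding set_integrable_def
    using integrable_cong_AE[OF borel_measurable_integrable[OF i] m ae] i by blast
  have "(LINT y:\<Omega>|lebesgue. (u x - u y) * k_beta s \<Omega> \<beta> x y) = (LINT y|lebesgue. LINT z|lebesgue. double_integrand x z y)"
    unfolding set_lebesgue_integral_def integral_double_integrand_z[OF x] ..
  also have "\<dots> = (LINT z|lebesgue. LINT y|lebesgue. double_integrand x z y)"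
    by (rule lebesgue_pair.Fubini_integral[OF int])
  also have "\<dots> = (LINT z:(- \<Omega>)|lebesgue. (1 - \<beta> z) * (u x - avg z) / dpow s x z)"
    unfolding set_lebesgue_integral_def
    by (rule integral_cong_AE[OF borel_measurable_integrable[OF i] m ae])
  finally show "(LINT y:\<Omega>|lebesgue. (u x - u y) * k_beta s \<Omega> \<beta> x y)
      = (LINT z:(- \<Omega>)|lebesgue. (1 - \<beta> z) * (u x - avg z) / dpow s x z)" .
qed

section \<open>Exterior integrals and principal values of \<open>u\<close> and \<beta>\<close>

lemma set_integrable_\<beta>_kernel:
  assumes "x \<in> \<Omega>"
  shows "set_integrable lebesgue (- \<Omega>) (\<lambda>z. \<beta> z / dpow s x z)"
proof -
  have "set_integrable lebesgue (- \<Omega>) (\<lambda>z. \<beta> z * (1 / dpow s x z))"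
  proof (rule set_integrable_bounded_mult[OF set_integrable_exterior_kernel[OF assms], where B = 1])
    show "(\<lambda>z. 1 / dpow s x z) \<in> borel_measurable lebesgue" by measurable
    show "AE z in lebesgue. z \<in> - \<Omega> \<longrightarrow> \<bar>\<beta> z\<bar> \<le> 1" using \<beta>_range by simp
  qed measurable
  then show ?thesis by simp
qed

lemma diff_quot_exterior:
  assumes x: "x \<in> \<Omega>"
  shows "set_integrable lebesgue (- \<Omega>) (diff_quot s u x)"
    and "(LINT z:(- \<Omega>)|lebesgue. diff_quot s u x z) =
      u x * (LINT z:(- \<Omega>)|lebesgue. \<beta> z / dpow s x z)
      + (LINT y:\<Omega>|lebesgue. (u x - u y) * k_beta s \<Omega> \<beta> x y)"
proof -
  let ?f = "\<lambda>z. u x * (\<beta> z / dpow s x z) + (1 - \<beta> z) * (u x - avg z) / dpow s x z"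
  have i: "set_integrable lebesgue (- \<Omega>) (\<lambda>z. u x * (\<beta> z / dpow s x z))"
    by (intro set_integrable_mult_right set_integrable_\<beta>_kernel x)
  have f: "set_integrable lebesgue (- \<Omega>) ?f"
    by (intro set_integral_add(1) i fubini(2) x)
  have ae: "AE z in lebesgue. z \<in> - \<Omega> \<longrightarrow> ?f z = diff_quot s u x z"
  proof -
    have "\<Omega> \<noteq> {}" using x by blast
    from u_exterior[OF this] show ?thesis
    proof eventually_elim
      case (elim z)
      show ?case
      proof
        assume "z \<in> - \<Omega>"
        then have "u x * \<beta> z + (1 - \<beta> z) * (u x - avg z) = u x - u z"
          using elim by (simp add: algebra_simps)
        then show "?f z = diff_quot s u x z"
          by (simp add: diff_quot_def add_divide_distrib[symmetric])
      qed
    qed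
  qed
  show "set_integrable lebesgue (- \<Omega>) (diff_quot s u x)"
    by (rule set_integrable_AE_cong(1)[OF f ae])
  show "(LINT z:(- \<Omega>)|lebesgue. diff_quot s u x z) =
      u x * (LINT z:(- \<Omega>)|lebesgue. \<beta> z / dpow s x z)
      + (LINT y:\<Omega>|lebesgue. (u x - u y) * k_beta s \<Omega> \<beta> x y)"
    unfolding set_integrable_AE_cong(2)[OF f ae] set_integral_add(2)[OF i fubini(2)[OF x]]
      fubini(3)[OF x] set_integral_mult_right ..
qed

text \<open>\<Omega> is cut at a small ball around \<open>x\<close>. Inside it the Taylor remainder
  over the kernel is absolutely integrable and the linear term has principal value 0; outside it the
  kernel is integrable and \<open>u\<close> is essentially bounded.\<close>

lemma has_pv_interior:
  assumes x: "x \<in> \<Omega>"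
  obtains A where "has_pv \<Omega> x (diff_quot s u x) A"
proof -
  obtain r0 where r0: "0 < r0" "cball x r0 \<subseteq> \<Omega>" using x open_\<Omega> open_contains_cball by blast
  \<comment> \<open>With |x - y| \<le> 1 the Taylor exponent can be lowered to \<open>g\<close> at
    no cost.\<close>
  define r where "r = min r0 1"
  have r: "0 < r" "r \<le> 1" "cball x r \<subseteq> \<Omega>" using r0 by (auto simp: r_def)
  then have b: "ball x r \<subseteq> \<Omega>" using ball_subset_cball by blast
  obtain C a where C: "0 \<le> C"
    "\<And>y. y \<in> cball x r \<Longrightarrow> \<bar>u x - u y - (x - y) \<bullet> a\<bar> \<le> C * norm (x - y) powr min (2 * s + \<alpha>) 2"
    using holder_loc_taylor[OF u_holder _ _ r(3)] s_pos \<alpha>_pos r(1) by auto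
  \<comment> \<open>Any exponent above 2s makes the remainder integrable, and
    \<open>\<alpha> > 0\<close> with \<open>s < 1\<close> leaves room for one. The cap at 2s + 1/2
    keeps \<open>p - g\<close> positive even for n = 1, as \<open>set_integrable_kernel_near\<close>
    requires.\<close>
  define g where "g = min (min (2 * s + \<alpha>) 2) (2 * s + 1 / 2)"
  have g: "2 * s < g" "g \<le> 2 * s + 1 / 2" "g \<le> min (2 * s + \<alpha>) 2"
    using \<alpha>_pos s_less_1 by (auto simp: g_def)
  have q: "0 < p - g" "p - g < real DIM('a)"
  proof -
    have "1 \<le> real DIM('a)" using DIM_positive[where 'a='a] by linarith
    then show "0 < p - g" "p - g < real DIM('a)" using g(1,2) unfolding p_def by linarith+
  qed
  have "set_integrable lebesgue (ball x r) (\<lambda>y. (u x - u y - (x - y) \<bullet> a) / dpow s x y)"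
  proof (rule set_integrable_bound[OF set_integrable_mult_right[of C]])
    show "set_integrable lebesgue (ball x r) (\<lambda>y. norm (x - y) powr - (p - g))"
      by (rule set_integrable_kernel_near[OF q r(1)])
    have [measurable]: "(\<lambda>y. (x - y) \<bullet> a) \<in> borel_measurable lebesgue"
      by (rule measurable_completion) simp
    have [measurable]: "ball x r \<in> sets lebesgue" by simp
    have "(\<lambda>y. (u x - u1 y - (x - y) \<bullet> a) / dpow s x y) \<in> borel_measurable lebesgue"
      by (intro borel_measurable_divide borel_measurable_diff borel_measurable_const u1_measurable
          borel_measurable_dpow_lebesgue(1)) measurable
    then have "(\<lambda>y. indicator (ball x r) y *\<^sub>R ((u x - u1 y - (x - y) \<bullet> a) / dpow s x y)) \<in> borel_measurable lebesgue"
      by (intro borel_measurable_scaleR borel_measurable_indicator) simp_all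
    moreover have "(\<lambda>y. indicator (ball x r) y *\<^sub>R ((u x - u1 y - (x - y) \<bullet> a) / dpow s x y))
        = (\<lambda>y. indicator (ball x r) y *\<^sub>R ((u x - u y - (x - y) \<bullet> a) / dpow s x y))"
      using b by (intro ext) (auto split: split_indicator simp: u1_eq subset_iff)
    ultimately show "set_borel_measurable lebesgue (ball x r) (\<lambda>y. (u x - u y - (x - y) \<bullet> a) / dpow s x y)"
      unfolding set_borel_measurable_def by (simp only:)
    show "AE y in lebesgue. y \<in> ball x r \<longrightarrow>
        norm ((u x - u y - (x - y) \<bullet> a) / dpow s x y) \<le> norm (C * norm (x - y) powr - (p - g))"
    proof (intro AE_I2 impI)
      fix y assume y: "y \<in> ball x r"
      then have n: "norm (x - y) \<le> 1" using r(2) by (simp add: dist_norm)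
      have "\<bar>u x - u y - (x - y) \<bullet> a\<bar> \<le> C * norm (x - y) powr min (2 * s + \<alpha>) 2"
        using C(2)[of y] y by simp
      also have "\<dots> \<le> C * norm (x - y) powr g"
        using C(1) n g(3) by (intro mult_left_mono powr_mono') auto
      finally have "\<bar>u x - u y - (x - y) \<bullet> a\<bar> / dpow s x y \<le> C * norm (x - y) powr g / dpow s x y"
        by (intro divide_right_mono) auto
      also have "\<dots> = C * norm (x - y) powr - (p - g)"
        by (simp add: dpow_eq powr_diff)
      finally show "norm ((u x - u y - (x - y) \<bullet> a) / dpow s x y) \<le> norm (C * norm (x - y) powr - (p - g))"
        using C(1) by simp
    qed
  qed
  from has_pv_add[OF has_pv_set_integrable[OF _ this] has_pv_linear_kernel[OF s_pos r(1)]]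
  obtain A1 where A1: "has_pv (ball x r) x (\<lambda>y. (u x - u y - (x - y) \<bullet> a) / dpow s x y + ((x - y) \<bullet> a) / dpow s x y) A1"
    by auto
  have near: "has_pv (ball x r) x (diff_quot s u x) A1"
    by (rule has_pv_cong[OF A1]) (simp add: diff_quot_def add_divide_distrib[symmetric])
  have S: "\<Omega> - ball x r \<in> sets lebesgue" by auto
  have "set_integrable lebesgue (\<Omega> - ball x r) (\<lambda>y. (u x - u1 y) * (1 / dpow s x y))"
  proof (rule set_integrable_bounded_mult[where B = "\<bar>u x\<bar> + u_bound"])
    show "set_integrable lebesgue (\<Omega> - ball x r) (\<lambda>y. 1 / dpow s x y)"
      using s_pos r(1) by (intro set_integrable_kernel_subset[of s r]) auto
    show "AE y in lebesgue. y \<in> \<Omega> - ball x r \<longrightarrow> \<bar>u x - u1 y\<bar> \<le> \<bar>u x\<bar> + u_bound"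
      using u_bound(2) by eventually_elim auto
  qed (use S in measurable)
  from has_pv_set_integrable[OF S this]
  have far: "has_pv (\<Omega> - ball x r) x (diff_quot s u x) (LINT y:\<Omega> - ball x r|lebesgue. (u x - u1 y) * (1 / dpow s x y))"
    by (rule has_pv_cong) (simp add: diff_quot_def u1_eq)
  have "has_pv (ball x r \<union> (\<Omega> - ball x r)) x (diff_quot s u x) (A1 + (LINT y:\<Omega> - ball x r|lebesgue. (u x - u1 y) * (1 / dpow s x y)))"
    by (rule has_pv_Un[OF near far]) auto
  moreover have "ball x r \<union> (\<Omega> - ball x r) = \<Omega>" using b by auto
  ultimately show thesis using that by simp
qed

text \<open>Both \<open>\<beta> x\<close> and the values of \<beta> in \<Omega> are 0, so the
  quotient vanishes in \<Omega> and is minus the nonsingular exterior kernel outside. This explains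
  the sign of the term with \<beta> in the theorem.\<close>

lemma has_pv_\<beta>:
  assumes x: "x \<in> \<Omega>"
  shows "has_pv UNIV x (diff_quot s \<beta> x) (- (LINT z:(- \<Omega>)|lebesgue. \<beta> z / dpow s x z))"
proof -
  have "has_pv \<Omega> x (\<lambda>_. 0) (LINT y:\<Omega>|lebesgue. 0)"
    by (rule has_pv_set_integrable) (auto simp: set_integrable_def)
  then have "has_pv \<Omega> x (\<lambda>_. 0) 0" by (simp add: set_lebesgue_integral_def)
  then have 1: "has_pv \<Omega> x (diff_quot s \<beta> x) 0"
    by (rule has_pv_cong) (simp add: diff_quot_def \<beta>_zero x)
  have "has_pv (- \<Omega>) x (\<lambda>z. -1 * (\<beta> z / dpow s x z)) (LINT z:(- \<Omega>)|lebesgue. -1 * (\<beta> z / dpow s x z))"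
    by (intro has_pv_set_integrable set_integrable_mult_right set_integrable_\<beta>_kernel x) simp
  then have 2: "has_pv (- \<Omega>) x (diff_quot s \<beta> x) (- (LINT z:(- \<Omega>)|lebesgue. \<beta> z / dpow s x z))"
    unfolding set_integral_mult_right unfolding mult_minus1
    by (rule has_pv_cong) (simp add: diff_quot_def \<beta>_zero x)
  have "has_pv (\<Omega> \<union> - \<Omega>) x (diff_quot s \<beta> x) (0 + - (LINT z:(- \<Omega>)|lebesgue. \<beta> z / dpow s x z))"
    by (rule has_pv_Un[OF 1 2]) auto
  then show ?thesis by simp
qed

end

section \<open>Assembling the two formulas\<close>

theorem theorem1p1:
  fixes \<Omega> :: "'a::euclidean_space set"
    and \<beta> u :: "'a \<Rightarrow> real"
    and s \<alpha> c :: real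
  assumes "0 < s" and "s < 1" and "0 < c"
    and "open \<Omega>" and "bounded \<Omega>" and "C11_boundary \<Omega>"
    and "\<beta> \<in> borel_measurable lebesgue"
    and "\<And>x. 0 \<le> \<beta> x \<and> \<beta> x \<le> 1"
    and "\<And>x. x \<in> \<Omega> \<Longrightarrow> \<beta> x = 0"
    and "0 < \<alpha>" and "holder_loc (2 * s + \<alpha>) \<Omega> u" and "Linfty_on \<Omega> u"
    and "AE x in lebesgue. x \<notin> \<Omega> \<longrightarrow> \<beta> x * u x + (1 - \<beta> x) * nonlocal_normal s \<Omega> u x = 0"
  shows
    \<comment> \<open>all integrals and principal values in the formulas exist\<close>
    "(\<forall>x\<in>\<Omega>.
        pv_exists UNIV x (diff_quot s u x) \<and>
        pv_exists \<Omega> x (diff_quot s u x) \<and>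
        pv_exists UNIV x (diff_quot s \<beta> x) \<and>
        set_integrable lebesgue \<Omega> (\<lambda>y. (u x - u y) * k_beta s \<Omega> \<beta> x y) \<and>
        pv_exists \<Omega> x (\<lambda>y. (u x - u y) * (1 / dpow s x y + k_beta s \<Omega> \<beta> x y)) \<and>
        set_integrable lebesgue (- \<Omega>) (\<lambda>y. \<beta> y / dpow s x y)) \<and>
     (\<forall>x\<in>\<Omega>. \<forall>y\<in>\<Omega>. set_integrable lebesgue (- \<Omega>) (k_beta_integrand s \<Omega> \<beta> x y)) \<and>
     (\<forall>x\<in>\<Omega>.
        frac_lap c s u x =
          reg_frac_lap c s \<Omega> u x - u x * frac_lap c s \<beta> x
          + c * (LINT y:\<Omega>|lebesgue. (u x - u y) * k_beta s \<Omega> \<beta> x y) \<and>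
        reg_frac_lap c s \<Omega> u x - u x * frac_lap c s \<beta> x
          + c * (LINT y:\<Omega>|lebesgue. (u x - u y) * k_beta s \<Omega> \<beta> x y) =
          c * pv_integral \<Omega> x (\<lambda>y. (u x - u y) * (1 / dpow s x y + k_beta s \<Omega> \<beta> x y))
          + u x * (c * (LINT y:(- \<Omega>)|lebesgue. \<beta> y / dpow s x y))) \<and>
     (\<forall>x\<in>\<Omega>. \<forall>y\<in>\<Omega>. 0 \<le> k_beta s \<Omega> \<beta> x y) \<and>
     (\<forall>x\<in>\<Omega>. \<forall>y\<in>\<Omega>. k_beta s \<Omega> \<beta> x y = k_beta s \<Omega> \<beta> y x) \<and>
     continuous_on (\<Omega> \<times> \<Omega>) (\<lambda>(x, y). k_beta s \<Omega> \<beta> x y) \<and>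
     (\<forall>x\<in>\<Omega>. \<exists>C>0. \<forall>y\<in>\<Omega>.
        ereal (k_beta s \<Omega> \<beta> x y) \<le>
          ereal C * (1 + \<bar>ext_ln (ext_dist y (robin_support \<Omega> \<beta>))\<bar>))"
proof -
  interpret robin_problem \<Omega> \<beta> s u \<alpha>
    using assms(1,2,4-13) by unfold_locales
  note pv = pv_exists_iff_has_pv
  let ?K = "\<lambda>x y. (u x - u y) * k_beta s \<Omega> \<beta> x y"
  have main: "pv_exists UNIV x (diff_quot s u x) \<and> pv_exists \<Omega> x (diff_quot s u x) \<and>
      pv_exists UNIV x (diff_quot s \<beta> x) \<and>
      pv_exists \<Omega> x (\<lambda>y. (u x - u y) * (1 / dpow s x y + k_beta s \<Omega> \<beta> x y)) \<and>
      frac_lap c s u x = reg_frac_lap c s \<Omega> u x - u x * frac_lap c s \<beta> x + c * (LINT y:\<Omega>|lebesgue. ?K x y) \<and>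
      reg_frac_lap c s \<Omega> u x - u x * frac_lap c s \<beta> x + c * (LINT y:\<Omega>|lebesgue. ?K x y) =
        c * pv_integral \<Omega> x (\<lambda>y. (u x - u y) * (1 / dpow s x y + k_beta s \<Omega> \<beta> x y))
        + u x * (c * (LINT y:(- \<Omega>)|lebesgue. \<beta> y / dpow s x y))"
    if x: "x \<in> \<Omega>" for x
  proof -
    obtain A where A: "has_pv \<Omega> x (diff_quot s u x) A" using has_pv_interior[OF x] .
    \<comment> \<open>In terms of \<open>A\<close>, \<open>b\<close> and \<open>k\<close> the
      principal values are \<open>A + (u x * b + k)\<close> for \<open>u\<close> on the whole space,
      \<open>A\<close> for \<open>u\<close> on \<Omega>, \<open>- b\<close> for \<beta>, and
      \<open>A + k\<close> with the kernel \<open>k_beta\<close> added; both equalities become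
      linear algebra.\<close>
    define b where "b = (LINT z:(- \<Omega>)|lebesgue. \<beta> z / dpow s x z)"
    define k where "k = (LINT y:\<Omega>|lebesgue. ?K x y)"
    have "has_pv (- \<Omega>) x (diff_quot s u x) (u x * b + k)"
      unfolding b_def k_def diff_quot_exterior(2)[OF x, symmetric]
      by (intro has_pv_set_integrable diff_quot_exterior(1) x) simp
    from has_pv_Un[OF A this] have U: "has_pv UNIV x (diff_quot s u x) (A + (u x * b + k))" by simp
    have B: "has_pv UNIV x (diff_quot s \<beta> x) (- b)" unfolding b_def by (rule has_pv_\<beta>[OF x])
    have "has_pv \<Omega> x (?K x) k" unfolding k_def by (intro has_pv_set_integrable fubini(1) x) simp
    from has_pv_add[OF A this]
    have K: "has_pv \<Omega> x (\<lambda>y. (u x - u y) * (1 / dpow s x y + k_beta s \<Omega> \<beta> x y)) (A + k)"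
      by (rule has_pv_cong) (simp add: diff_quot_def ring_distribs)
    show ?thesis
      unfolding frac_lap_def reg_frac_lap_def pv_integral_eq[OF A] pv_integral_eq[OF U]
        pv_integral_eq[OF B] pv_integral_eq[OF K] b_def[symmetric] k_def[symmetric]
      using A U B K unfolding pv by (auto simp: algebra_simps)
  qed
  show ?thesis
    using main fubini(1) set_integrable_\<beta>_kernel set_integrable_k_beta_integrand k_beta_nonneg
      k_beta_commute continuous_on_k_beta k_beta_ext_log_bound
    by (intro conjI ballI) blast+
qed

end
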